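(* Let $\alpha\in(0,1)$, let $f_\alpha$ be the positive $\alpha$-stable density on $(0,\infty)$, and let $h\ge 0$ be a function on $(0,\infty)$ such that $\gamma(t)=h(t)f_\alpha(t)$ is a probability density. Let $V_{n,k}=V_{n,k}^{\alpha,h}$ be the Gibbs weights of the $PK(\rho_\alpha,h\times f_\alpha)$ partition model. Fix integers $1\le k\le n$ and $s\in(0,\infty)$. Then, for large $m$ and $k^*\approx s m^{\alpha}$ (that is, as $m\to\infty$ along integers $k^*=k^*_m$ with $1\le k^*\le m$ and $k^*/m^{\alpha}\to s$), $$ \frac{V_{n+m,k+k^*}}{V_{n,k}}\approx \frac{h(s^{-1/\alpha})\,s^k\,\alpha^{k^*}\,\Gamma(k^* )\,\Gamma(n)\,m^{-(n-k\alpha)}}{\mathbb{E}_{n,k}^{\alpha}\!\left[h(S^{-1/\alpha})\right]\Gamma(m)\,\Gamma(k)}=\frac{\alpha^{k+k^*-1}\,h(s^{-1/\alpha})\,s^{k}\,\Gamma(k^* )\,m^{-(n-k\alpha)}}{V_{n,k}\,\Gamma(m)}, $$ where $\approx$ between the first two expressions means that their ratio tends to $1$.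
   Context: Stable density: $f_\alpha$ is the density on $(0,\infty)$ with Laplace transform $\int_0^\infty e^{-\lambda t}f_\alpha(t)\,dt=e^{-\lambda^\alpha}$, $\lambda\ge 0$; $\rho_\alpha$ is the Lévy density of the corresponding stable subordinator. Rising factorials: $(x)_n=x(x+1)\cdots(x+n-1)$, $(x)_0=1$. Gibbs partitions: an exchangeable Gibbs partition of $\mathbb{N}$ with parameter $\alpha$ is an infinite exchangeable partition whose exchangeable partition probability function (EPPF), i.e. the probability that the restriction to $\{1,\dots,n\}$ is a given partition with block sizes $(n_1,\dots,n_k)$, has the form $$p(n_1,\dots,n_k)=V_{n,k}\prod_{j=1}^k(1-\alpha)_{n_j-1},$$ with $V_{1,1}=1$ and $V_{n,k}=(n-k\alpha)V_{n+1,k}+V_{n+1,k+1}$. Poisson-Kingman weights: the $PK(\rho_\alpha,h\times f_\alpha)$ model, with mixing density $\gamma(t)=h(t)f_\alpha(t)$, is the Gibbs partition of parameter $\alpha$ whose weights are $$V_{n,k}^{\alpha,h}=\int_0^\infty \frac{\alpha^k}{\Gamma(n-k\alpha)}\,t^{-k\alpha}\left[\int_0^1 p^{\,n-1-k\alpha}f_\alpha((1-p)t)\,dp\right]h(t)\,dt .$$ The expectation $\mathbb{E}_{n,k}^{\alpha}$: $\mathbb{E}_{n,k}^{\alpha}[h(S^{-1/\alpha})]=\int_0^\infty h(x^{-1/\alpha})\,\tilde g_{n,k}^{\alpha}(x)\,dx$, where $S$ has density on $(0,\infty)$ $$\tilde g_{n,k}^{\alpha}(x)=\frac{\Gamma(n)}{\Gamma(n-k\alpha)\,\Gamma(k)}\,x^{k-1/\alpha-1}\int_0^1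 p^{\,n-1-k\alpha}f_\alpha\big((1-p)x^{-1/\alpha}\big)\,dp .$$
   Formalization: Added hypotheses: h is Borel measurable, continuous at the point s^{-1/α}, and h(s^{-1/α})>0; without them the claim fails (changing h at that one point changes only the right side) or the ratio is undefined. *)

theory Defs
  imports "HOL-Analysis.Analysis"
begin

definition density_on_pos :: "(real \<Rightarrow> real) \<Rightarrow> bool" where
  "density_on_pos g \<longleftrightarrow>
     set_borel_measurable lborel {0<..} g \<and>
     (\<forall>t>0. g t \<ge> 0) \<and>
     (LINT t:{0<..}|lborel. g t) = 1"

text \<open>
  The Laplace transform determines the density only up to Lebesgue-null sets; no version is
  singled out, since all quantities below depend on it through integrals only.
\<close>

definition stable_density :: "real \<Rightarrow> (real \<Rightarrow> real) \<Rightarrow> bool" where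
  "stable_density \<alpha> f \<longleftrightarrow>
     density_on_pos f \<and>
     (\<forall>l\<ge>0. (LINT t:{0<..}|lborel. exp (- l * t) * f t) = exp (- (l powr \<alpha>)))"

text \<open>
  In the following definitions the argument \<open>f\<close> is meant to satisfy \<^term>\<open>stable_density \<alpha> f\<close>;
  \<open>gibbs_V \<alpha> f h n k\<close> is the weight of the Poisson-Kingman model with mixing density
  \<open>h t * f t\<close>.
\<close>

definition gibbs_V :: "real \<Rightarrow> (real \<Rightarrow> real) \<Rightarrow> (real \<Rightarrow> real) \<Rightarrow> nat \<Rightarrow> nat \<Rightarrow> real" where
  "gibbs_V \<alpha> f h n k =
     (LINT t:{0<..}|lborel.
        \<alpha> ^ k / Gamma (real n - real k * \<alpha>) * t powr (- real k * \<alpha>) *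
        (LINT p:{0<..<1}|lborel. p powr (real n - 1 - real k * \<alpha>) * f ((1 - p) * t)) * h t)"

definition S_density :: "real \<Rightarrow> (real \<Rightarrow> real) \<Rightarrow> nat \<Rightarrow> nat \<Rightarrow> real \<Rightarrow> real" where
  "S_density \<alpha> f n k x =
     Gamma (real n) / (Gamma (real n - real k * \<alpha>) * Gamma (real k)) *
     x powr (real k - 1 / \<alpha> - 1) *
     (LINT p:{0<..<1}|lborel.
        p powr (real n - 1 - real k * \<alpha>) * f ((1 - p) * x powr (- 1 / \<alpha>)))"

text \<open>\<open>S_expectation \<alpha> f n k \<phi>\<close> is the expectation of \<open>\<phi>(S)\<close>, where \<open>S\<close> has the density above.\<close>

definition S_expectation ::
    "real \<Rightarrow> (real \<Rightarrow> real) \<Rightarrow> nat \<Rightarrow> nat \<Rightarrow> (real \<Rightarrow> real) \<Rightarrow> real" where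
  "S_expectation \<alpha> f n k \<phi> = (LINT x:{0<..}|lborel. \<phi> x * S_density \<alpha> f n k x)"

end

theory Submission imports Defs "HOL-Probability.Probability" begin

text \<open>
  Write \<open>I\<^sup>b f\<close> for the fractional integral of order \<open>b\<close>. Up to the factor
  \<open>\<alpha> ^ (k - 1) * Gamma k / Gamma n\<close>, the weight \<open>V\<^bsub>n,k\<^esub>\<close> is the integral of \<open>h\<close> against the
  probability density \<open>g\<^bsub>n,k\<^esub>(t) = \<alpha> * Gamma n / Gamma k * t powr (- n) * I\<^bsup>n - k\<alpha>\<^esup> f t\<close>, so the
  theorem says that \<open>g\<^bsub>n+m,k+k*\<^esub>\<close> concentrates at \<open>t = s powr (- 1 / \<alpha>)\<close>, plus Stirling-type
  asymptotics of Gamma quotients.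

  As \<open>h\<close> is only known to be integrable against \<open>f\<close>, concentration is needed in the strong form
  \<open>g\<^bsub>N,K\<^esub> \<le> \<epsilon> * f\<close> almost everywhere away from that point. Since \<open>t * f t = \<alpha> * I\<^bsup>1-\<alpha>\<^esup> f t\<close> (Laplace
  transforms), all these densities are dominated by multiples of \<open>f\<close>. For \<open>t\<close> not too small, the bound
  \<open>(t - v) powr (b - 1) \<le> t powr (b - 1) * exp (- (b - 1) * v / t)\<close> in the fractional integral
  gives an explicit upper estimate which is compared with
  \<open>f t \<ge> c * t powr (- 1 - \<alpha>) * exp (- (2 / t) powr (\<alpha> / (1 - \<alpha>)))\<close>; for tiny \<open>t\<close>, each step
  \<open>I\<^bsup>b+1\<^esup> f \<le> C * t powr e * I\<^sup>b f\<close> with \<open>e\<close> close to \<open>1 / (1 - \<alpha>)\<close> gains enough.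
\<close>

section \<open>Laplace transforms, convolutions and the Gamma function\<close>

text \<open>Why two regimes of \<open>t\<close>, and why an exponent close to 1/(1-\<alpha>): write
  r = \<alpha>/(1-\<alpha>), and let N be the first index, the second being of order N^\<alpha>. The
  explicit estimate, divided by the lower bound for \<open>f\<close>, carries the loss exp((2/t)^r).
  Since r - \<alpha> = \<alpha> r, this is harmless against exp(-(N/t)^\<alpha>) only while t^(-r)
  is small compared with N. For smaller \<open>t\<close>, about N^\<theta> improved steps with
  \<theta> > \<alpha> are taken, so that 2^(-N^\<theta>) beats a loss of the form (N/\<alpha>)^K
  with K of order N^\<alpha>; they succeed once N^\<theta> t^(e-1) is small. The two regimes overlap
  when e - 1 > \<theta> r. The exponent e = 1 + \<alpha>, which self-convolution gives at once,
  would allow this only for \<alpha> < 1/2. Hence the iteration of e -> 1 + \<alpha> e towards its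
  fixed point 1/(1-\<alpha>), a value that reflects the decay exp(-c t^(-r)) of a stable density at
  0. Multiplicative constants may be poor throughout; only exponents matter.\<close>

lemma real_distribution_eq_of_moments:
  assumes "real_distribution M" and "real_distribution N"
    and bM: "AE x in M. \<bar>x\<bar> \<le> 1" and bN: "AE x in N. \<bar>x\<bar> \<le> 1"
    and mom: "\<And>n::nat. (LINT x|M. x ^ n) = (LINT x|N. x ^ n)"
  shows "M = N"
proof (rule Levy_uniqueness[OF assms(1,2)], rule ext)
  fix t :: real
  have *: "(\<lambda>n. \<Sum>k\<le>n. ((\<i> * t)^k / fact k) * (LINT x|M. x ^ k)) \<longlonglongrightarrow> char M t"
    if rd: "real_distribution M" and b: "AE x in M. \<bar>x\<bar> \<le> 1" for M
  proof -
    interpret real_distribution M by fact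
    have int: "integrable M (\<lambda>x. x ^ k)" for k
    proof (rule integrable_const_bound[where B = 1])
      show "AE x in M. norm (x ^ k) \<le> 1"
        using b by eventually_elim (simp add: power_abs power_le_one)
    qed simp
    have le1: "expectation (\<lambda>x. \<bar>x\<bar> ^ n) \<le> 1" for n
    proof -
      have "expectation (\<lambda>x. \<bar>x\<bar> ^ n) \<le> expectation (\<lambda>x. 1)"
      proof (rule integral_mono_AE)
        show "integrable M (\<lambda>x. \<bar>x\<bar> ^ n)"
          using integrable_norm[OF int[of n]] by (simp add: power_abs)
        show "AE x in M. \<bar>x\<bar> ^ n \<le> 1"
          using b by eventually_elim (simp add: power_le_one)
      qed simp
        also have "\<dots> = prob UNIV" by simp
      also have "\<dots> \<le> 1" by (rule prob_le_1)
      finally show ?thesis .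
    qed
    \<comment> \<open>Moments bounded by 1 make the Taylor remainder of the characteristic function
      at most 2 |t|^n / n!, so the moments determine \<open>char M\<close>.\<close>
    have "(\<lambda>n. char M t - (\<Sum>k\<le>n. ((\<i> * t)^k / fact k) * expectation (\<lambda>x. x ^ k))) \<longlonglongrightarrow> 0"
    proof (rule Lim_null_comparison)
      show "\<forall>\<^sub>F n in sequentially.
          norm (char M t - (\<Sum>k\<le>n. ((\<i> * t)^k / fact k) * expectation (\<lambda>x. x ^ k)))
          \<le> 2 * (\<bar>t\<bar> ^ n / fact n)"
      proof (rule always_eventually, rule allI)
        fix n
        have "norm (char M t - (\<Sum>k\<le>n. ((\<i> * t)^k / fact k) * expectation (\<lambda>x. x ^ k)))
            \<le> (2 * \<bar>t\<bar> ^ n / fact n) * expectation (\<lambda>x. \<bar>x\<bar> ^ n)"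
          by (rule char_approx1) (rule int)
        also have "\<dots> \<le> (2 * \<bar>t\<bar> ^ n / fact n) * 1"
          by (rule mult_left_mono[OF le1]) simp
        finally show "norm (char M t - (\<Sum>k\<le>n. ((\<i> * t)^k / fact k) * expectation (\<lambda>x. x ^ k)))
          \<le> 2 * (\<bar>t\<bar> ^ n / fact n)" by simp
      qed
      show "(\<lambda>n. 2 * (\<bar>t\<bar> ^ n / fact n)) \<longlonglongrightarrow> 0"
        using tendsto_mult[OF tendsto_const[of "2::real"]
            summable_LIMSEQ_zero[OF summable_exp[of "\<bar>t\<bar>"]]]
        by (simp add: field_simps)
    qed
    from tendsto_diff[OF tendsto_const[of "char M t"] this] show ?thesis by simp
  qed
  from *[OF assms(1) bM] *[OF assms(2) bN] show "char M t = char N t"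
    unfolding mom by (rule LIMSEQ_unique)
qed

text \<open>The map t -> exp(-t) carries the half-line into (0,1) and turns the values of the
  Laplace transform at natural numbers into moments, so the bounded moment problem applies; -ln then
  recovers the original measure.\<close>

lemma laplace_transform_unique:
  fixes g1 g2 :: "real \<Rightarrow> ennreal"
  assumes m1 [measurable]: "g1 \<in> borel_measurable borel"
    and m2 [measurable]: "g2 \<in> borel_measurable borel"
    and s1: "\<And>t. t \<le> 0 \<Longrightarrow> g1 t = 0" and s2: "\<And>t. t \<le> 0 \<Longrightarrow> g2 t = 0"
    and mass: "(\<integral>\<^sup>+t. g1 t \<partial>lborel) = 1"
    and eq: "\<And>n::nat. (\<integral>\<^sup>+t. ennreal (exp (- real n * t)) * g1 t \<partial>lborel) =
                (\<integral>\<^sup>+t. ennreal (exp (- real n * t)) * g2 t \<partial>lborel)"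
  shows "AE t in lborel. g1 t = g2 t"
proof -
  define D where "D g = distr (density lborel g) borel (\<lambda>t::real. exp (- t))" for g
  have E: "distr (D g) borel (\<lambda>x. - ln x) = density lborel g"
    if [measurable]: "g \<in> borel_measurable borel" for g :: "real \<Rightarrow> ennreal"
  proof -
    have "distr (D g) borel (\<lambda>x. - ln x) = distr (density lborel g) borel (\<lambda>x. x)"
      unfolding D_def by (subst distr_distr) (auto simp: comp_def)
    also have "\<dots> = density lborel g" by (rule distr_id2) simp
    finally show ?thesis .
  qed
  have *: "real_distribution (D g) \<and> (AE x in D g. \<bar>x\<bar> \<le> 1) \<and>
       (\<forall>n. (LINT x|D g. x ^ n) =
          enn2real (\<integral>\<^sup>+t. ennreal (exp (- real n * t)) * g t \<partial>lborel))"
    if [measurable]: "g \<in> borel_measurable borel"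
      and "\<And>t. t \<le> 0 \<Longrightarrow> g t = 0" and "(\<integral>\<^sup>+t. g t \<partial>lborel) = 1" for g :: "real \<Rightarrow> ennreal"
  proof (intro conjI allI)
    interpret prob_space "density lborel g"
      by (rule prob_spaceI) (use that(3) in \<open>simp add: emeasure_density\<close>)
    show "real_distribution (D g)" unfolding D_def by (rule real_distribution_distr) simp
    show "AE x in D g. \<bar>x\<bar> \<le> 1"
      unfolding D_def
    proof (subst AE_distr_iff)
      have "AE t in lborel. 0 < g t \<longrightarrow> \<bar>exp (- t)\<bar> \<le> 1"
      proof (rule AE_I2, rule impI)
        fix t assume "0 < g t"
        hence "\<not> t \<le> 0" using that(2)[of t] by auto
        thus "\<bar>exp (- t)\<bar> \<le> 1" by simp
      qed
      thus "AE t in density lborel g. \<bar>exp (- t)\<bar> \<le> 1" by (subst AE_density) simp_all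
    qed auto
    fix n :: nat
    have "(LINT x|D g. x ^ n) = (LINT t|density lborel g. exp (- t) ^ n)"
      unfolding D_def by (subst integral_distr) auto
    also have "\<dots> = enn2real (\<integral>\<^sup>+t. ennreal (exp (- t) ^ n) \<partial>density lborel g)"
      by (rule integral_eq_nn_integral) auto
    also have "(\<integral>\<^sup>+t. ennreal (exp (- t) ^ n) \<partial>density lborel g) =
        (\<integral>\<^sup>+t. ennreal (exp (- real n * t)) * g t \<partial>lborel)"
      by (subst nn_integral_density) (auto simp: exp_of_nat_mult[symmetric] mult.commute)
    finally show "(LINT x|D g. x ^ n) =
        enn2real (\<integral>\<^sup>+t. ennreal (exp (- real n * t)) * g t \<partial>lborel)" .
  qed
  have mass2: "(\<integral>\<^sup>+t. g2 t \<partial>lborel) = 1" using eq[of 0] mass by simp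
  have "D g1 = D g2"
    using *[OF m1 s1 mass] *[OF m2 s2 mass2] eq
    by (intro real_distribution_eq_of_moments) auto
  hence "density lborel g1 = density lborel g2" using E[OF m1] E[OF m2] by simp
  thus ?thesis by (intro sigma_finite_measure.density_unique[OF sigma_finite_lborel]) simp_all
qed

text \<open>Negative \<open>c\<close> is included, since both \<alpha> and -1/\<alpha> occur as
  exponents. The change of variables theorem compares finite values; because the equivalence holds
  for every finite \<open>b\<close>, the two integrals are also infinite together.\<close>

lemma nn_integral_power_substitution:
  fixes g :: "real \<Rightarrow> real"
  assumes [measurable]: "g \<in> borel_measurable borel" and c: "c \<noteq> 0"
    and nn: "\<And>x. 0 < x \<Longrightarrow> 0 \<le> g x"
  shows "(\<integral>\<^sup>+x\<in>{0<..}. ennreal (g x) \<partial>lborel) =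
         (\<integral>\<^sup>+t\<in>{0<..}. ennreal (\<bar>c\<bar> * t powr (c - 1) * g (t powr c)) \<partial>lborel)"
proof -
  define G where "G t = \<bar>c * t powr (c - 1)\<bar> * g (t powr c)" for t :: real
  have Gm [measurable]: "G \<in> borel_measurable borel" unfolding G_def by measurable
  have Gnn: "0 \<le> G x" if "0 < x" for x using nn[of "x powr c"] that by (simp add: G_def)
  have img: "(\<lambda>t::real. t powr c) ` {0<..} = {0<..}"
  proof (intro equalityI subsetI)
    fix x :: real assume "x \<in> {0<..}"
    thus "x \<in> (\<lambda>t. t powr c) ` {0<..}"
      using c by (intro image_eqI[of _ _ "x powr (1 / c)"]) (auto simp: powr_powr)
  qed auto
  have inj: "inj_on (\<lambda>t::real. t powr c) {0<..}"
  proof (rule inj_onI)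
    fix x y :: real assume "x \<in> {0<..}" "y \<in> {0<..}" "x powr c = y powr c"
    hence "(x powr c) powr (1 / c) = (y powr c) powr (1 / c)" by simp
    thus "x = y" using c \<open>x \<in> _\<close> \<open>y \<in> _\<close> by (simp add: powr_powr)
  qed
  have der: "((\<lambda>t. t powr c) has_field_derivative (c * t powr (c - 1))) (at t within {0<..})"
    if "t \<in> {0<..}" for t :: real
    using that by (auto intro!: derivative_eq_intros)
  have cv: "G absolutely_integrable_on {0<..} \<and> integral {0<..} G = b \<longleftrightarrow>
      g absolutely_integrable_on {0<..} \<and> integral {0<..} g = b" for b
    using has_absolute_integral_change_of_variables_1'[OF _ der inj, of g b] img
    by (simp add: G_def[abs_def])
  have fin: "u absolutely_integrable_on {0<..} \<and> integral {0<..} u = b \<longleftrightarrow>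
      (\<integral>\<^sup>+x\<in>{0<..}. ennreal (u x) \<partial>lborel) = ennreal b"
    if [measurable]: "u \<in> borel_measurable borel" and un: "\<And>x. 0 < x \<Longrightarrow> 0 \<le> u x" and b: "0 \<le> b"
    for u :: "real \<Rightarrow> real" and b
  proof -
    have "u absolutely_integrable_on {0<..} \<and> integral {0<..} u = b \<longleftrightarrow> (u has_integral b) {0<..}"
      using un nonnegative_absolutely_integrable_1[of u "{0<..}"]
      by (auto simp: has_integral_iff absolutely_integrable_on_def)
    also have "\<dots> \<longleftrightarrow> ((\<lambda>x. indicator {0<..} x * u x) has_integral b) UNIV"
      by (subst has_integral_restrict_UNIV[symmetric])
        (simp add: indicator_def of_bool_def if_distrib if_distribR cong: if_cong)
    also have "\<dots> \<longleftrightarrow> (\<integral>\<^sup>+x. ennreal (indicator {0<..} x * u x) \<partial>lborel) = ennreal b"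
    proof
      assume "((\<lambda>x. indicator {0<..} x * u x) has_integral b) UNIV"
      thus "(\<integral>\<^sup>+x. ennreal (indicator {0<..} x * u x) \<partial>lborel) = ennreal b"
        using un by (intro nn_integral_has_integral_lborel) (auto simp: indicator_def)
    next
      assume "(\<integral>\<^sup>+x. ennreal (indicator {0<..} x * u x) \<partial>lborel) = ennreal b"
      thus "((\<lambda>x. indicator {0<..} x * u x) has_integral b) UNIV"
        using un b by (intro nn_integral_has_integral) (auto simp: indicator_def)
    qed
    also have "(\<integral>\<^sup>+x. ennreal (indicator {0<..} x * u x) \<partial>lborel) =
        (\<integral>\<^sup>+x\<in>{0<..}. ennreal (u x) \<partial>lborel)"
      by (intro nn_integral_cong) (simp add: indicator_def)
    finally show ?thesis .
  qed
  have main: "(\<integral>\<^sup>+x\<in>{0<..}. ennreal (g x) \<partial>lborel) = ennreal b \<longleftrightarrow>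
      (\<integral>\<^sup>+x\<in>{0<..}. ennreal (G x) \<partial>lborel) = ennreal b" if "0 \<le> b" for b
    using cv[of b] fin[OF _ nn that] fin[OF Gm _ that] nn by (simp add: Gnn)
  have "(\<integral>\<^sup>+x\<in>{0<..}. ennreal (g x) \<partial>lborel) = (\<integral>\<^sup>+x\<in>{0<..}. ennreal (G x) \<partial>lborel)"
  proof (cases "(\<integral>\<^sup>+x\<in>{0<..}. ennreal (g x) \<partial>lborel)")
    case (real r) thus ?thesis using main[of r] by simp
  next
    case top thus ?thesis
      using main by (cases "(\<integral>\<^sup>+x\<in>{0<..}. ennreal (G x) \<partial>lborel)") force+
  qed
  thus ?thesis by (simp add: G_def abs_mult)
qed

text \<open>Exponential tilting: the factor exp(-t)/c produces a probability density and shifts the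
  argument of the transform by 1. Values at l > 0 then suffice, which suits fractional integrals,
  whose transforms l^(-b) exp(-l^\<alpha>) are singular at 0.\<close>

corollary laplace_transform_unique_pos:
  fixes g1 g2 :: "real \<Rightarrow> ennreal"
  assumes m1 [measurable]: "g1 \<in> borel_measurable borel"
    and m2 [measurable]: "g2 \<in> borel_measurable borel"
    and s1: "\<And>t. t \<le> 0 \<Longrightarrow> g1 t = 0" and s2: "\<And>t. t \<le> 0 \<Longrightarrow> g2 t = 0"
    and mass: "(\<integral>\<^sup>+t. ennreal (exp (- t)) * g1 t \<partial>lborel) = ennreal c" and c: "0 < c"
    and eq: "\<And>l. 0 < l \<Longrightarrow> (\<integral>\<^sup>+t. ennreal (exp (- l * t)) * g1 t \<partial>lborel) =
                (\<integral>\<^sup>+t. ennreal (exp (- l * t)) * g2 t \<partial>lborel)"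
  shows "AE t in lborel. g1 t = g2 t"
proof -
  define G where "G g t = ennreal (exp (- t) / c) * g t" for g :: "real \<Rightarrow> ennreal" and t
  have shift: "(\<integral>\<^sup>+t. ennreal (exp (- real n * t)) * G g t \<partial>lborel) =
      ennreal (1 / c) * (\<integral>\<^sup>+t. ennreal (exp (- (real n + 1) * t)) * g t \<partial>lborel)"
    if [measurable]: "g \<in> borel_measurable borel" for g n
  proof -
    have "ennreal (exp (- real n * t)) * G g t =
        ennreal (1 / c) * (ennreal (exp (- (real n + 1) * t)) * g t)" for t
    proof -
      have "exp (- real n * t) * (exp (- t) / c) = 1 / c * exp (- (real n + 1) * t)"
        by (simp add: exp_add[symmetric] algebra_simps)
      hence "ennreal (exp (- real n * t)) * ennreal (exp (- t) / c) =
          ennreal (1 / c) * ennreal (exp (- (real n + 1) * t))"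
        using c by (simp only: ennreal_mult[symmetric] exp_ge_zero divide_nonneg_pos
            zero_le_one less_imp_le)
      thus ?thesis unfolding G_def by (simp add: mult.assoc[symmetric])
    qed
    thus ?thesis by (simp add: nn_integral_cmult)
  qed
  have "AE t in lborel. G g1 t = G g2 t"
  proof (rule laplace_transform_unique)
    show "(\<integral>\<^sup>+t. G g1 t \<partial>lborel) = 1"
    proof -
      have "(\<integral>\<^sup>+t. G g1 t \<partial>lborel) = ennreal (1 / c) * ennreal c"
        using shift[OF m1, of 0] mass by simp
      also have "\<dots> = 1" using c by (subst ennreal_mult[symmetric]) simp_all
      finally show ?thesis .
    qed
  next
    fix n :: nat
    have "0 < real n + 1" by simp
    from eq[OF this]
    show "(\<integral>\<^sup>+t. ennreal (exp (- real n * t)) * G g1 t \<partial>lborel) =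
        (\<integral>\<^sup>+t. ennreal (exp (- real n * t)) * G g2 t \<partial>lborel)"
      by (simp only: shift[OF m1] shift[OF m2])
  qed (use s1 s2 in \<open>simp_all add: G_def[abs_def]\<close>)
  thus ?thesis
  proof eventually_elim
    fix t assume "G g1 t = G g2 t"
    moreover have "0 < exp (- t) / c" using c by simp
    ultimately show "g1 t = g2 t"
      unfolding G_def using c by (simp add: ennreal_mult_cancel_left)
  qed
qed

section \<open>Convolutions and fractional integral kernels\<close>

text \<open>With values in \<open>ennreal\<close>, Tonelli's theorem, associativity and the product
  rule for transforms hold without integrability conditions.\<close>

definition conv :: "(real \<Rightarrow> ennreal) \<Rightarrow> (real \<Rightarrow> ennreal) \<Rightarrow> real \<Rightarrow> ennreal" where
  "conv a b t = (\<integral>\<^sup>+v. a (t - v) * b v \<partial>lborel)"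

definition laplace :: "(real \<Rightarrow> ennreal) \<Rightarrow> real \<Rightarrow> ennreal" where
  "laplace g l = (\<integral>\<^sup>+t. ennreal (exp (- l * t)) * g t \<partial>lborel)"

text \<open>Convolution with \<open>kern b\<close> is the Riemann-Liouville fractional integral of order \<open>b\<close>.\<close>

definition kern :: "real \<Rightarrow> real \<Rightarrow> ennreal" where
  "kern b u = ennreal (if 0 < u then u powr (b - 1) / Gamma b else 0)"

lemma measurable_kern [measurable]: "kern b \<in> borel_measurable borel"
  unfolding kern_def by measurable

lemma measurable_conv [measurable]:
  assumes [measurable]: "a \<in> borel_measurable borel" "b \<in> borel_measurable borel"
  shows "conv a b \<in> borel_measurable borel"
  unfolding conv_def[abs_def] by measurable

lemma nn_integral_shift:
  fixes w :: real
  assumes [measurable]: "g \<in> borel_measurable borel"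
  shows "(\<integral>\<^sup>+v. g (v - w) \<partial>lborel) = (\<integral>\<^sup>+v. g v \<partial>lborel)"
  using nn_integral_real_affine[of g 1 "-w"] by (simp add: add.commute)

lemma conv_assoc:
  assumes [measurable]: "a \<in> borel_measurable borel" "b \<in> borel_measurable borel"
    "c \<in> borel_measurable borel"
  shows "conv a (conv b c) t = conv (conv a b) c t"
proof -
  have "conv a (conv b c) t = (\<integral>\<^sup>+v. (\<integral>\<^sup>+w. a (t - v) * (b (v - w) * c w) \<partial>lborel) \<partial>lborel)"
    unfolding conv_def by (intro nn_integral_cong nn_integral_cmult[symmetric]) measurable
  also have "\<dots> = (\<integral>\<^sup>+w. (\<integral>\<^sup>+v. a (t - v) * (b (v - w) * c w) \<partial>lborel) \<partial>lborel)"
    by (rule lborel_pair.Fubini') measurable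
  also have "\<dots> = conv (conv a b) c t"
    unfolding conv_def
  proof (rule nn_integral_cong)
    fix w
    have "(\<integral>\<^sup>+v. a (t - v) * (b (v - w) * c w) \<partial>lborel) =
        (\<integral>\<^sup>+v. a (t - v) * b (v - w) \<partial>lborel) * c w"
      by (subst nn_integral_multc[symmetric]) (auto simp: mult.assoc)
    also have "(\<integral>\<^sup>+v. a (t - v) * b (v - w) \<partial>lborel) = (\<integral>\<^sup>+v. a (t - w - v) * b v \<partial>lborel)"
      using nn_integral_shift[of "\<lambda>v. a (t - w - v) * b v" w] by simp
    finally show "(\<integral>\<^sup>+v. a (t - v) * (b (v - w) * c w) \<partial>lborel) =
        (\<integral>\<^sup>+v. a (t - w - v) * b v \<partial>lborel) * c w" .
  qed
  finally show ?thesis .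
qed

lemma laplace_conv:
  assumes [measurable]: "a \<in> borel_measurable borel" "b \<in> borel_measurable borel"
  shows "laplace (conv a b) l = laplace a l * laplace b l"
proof -
  have "laplace (conv a b) l =
      (\<integral>\<^sup>+t. (\<integral>\<^sup>+v. ennreal (exp (- l * t)) * (a (t - v) * b v) \<partial>lborel) \<partial>lborel)"
    unfolding conv_def laplace_def by (intro nn_integral_cong nn_integral_cmult[symmetric]) measurable
  also have "\<dots> = (\<integral>\<^sup>+v. (\<integral>\<^sup>+t. ennreal (exp (- l * t)) * (a (t - v) * b v) \<partial>lborel) \<partial>lborel)"
    by (rule lborel_pair.Fubini') measurable
  also have "\<dots> = (\<integral>\<^sup>+v. laplace a l * (ennreal (exp (- l * v)) * b v) \<partial>lborel)"
  proof (rule nn_integral_cong)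
    fix v
    have "ennreal (exp (- l * t)) * (a (t - v) * b v) =
        ennreal (exp (- l * (t - v))) * a (t - v) * (ennreal (exp (- l * v)) * b v)" for t
    proof -
      have "ennreal (exp (- l * t)) = ennreal (exp (- l * (t - v))) * ennreal (exp (- l * v))"
        by (simp add: ennreal_mult[symmetric] exp_add[symmetric] algebra_simps)
      thus ?thesis by (simp add: mult_ac)
    qed
    hence "(\<integral>\<^sup>+t. ennreal (exp (- l * t)) * (a (t - v) * b v) \<partial>lborel) =
        (\<integral>\<^sup>+t. ennreal (exp (- l * (t - v))) * a (t - v) \<partial>lborel) * (ennreal (exp (- l * v)) * b v)"
      by (simp add: nn_integral_multc)
    also have "(\<integral>\<^sup>+t. ennreal (exp (- l * (t - v))) * a (t - v) \<partial>lborel) = laplace a l"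
      unfolding laplace_def by (rule nn_integral_shift) measurable
    finally show "(\<integral>\<^sup>+t. ennreal (exp (- l * t)) * (a (t - v) * b v) \<partial>lborel) =
        laplace a l * (ennreal (exp (- l * v)) * b v)" .
  qed
  also have "\<dots> = laplace a l * laplace b l"
    unfolding laplace_def[of b] by (rule nn_integral_cmult) measurable
  finally show ?thesis .
qed

lemma nn_integral_Gamma:
  assumes b: "0 < b" and l: "0 < l"
  shows "(\<integral>\<^sup>+t. ennreal (if 0 < t then t powr (b - 1) * exp (- l * t) else 0) \<partial>lborel) =
    ennreal (Gamma b * l powr (- b))"
proof -
  have "ennreal (Gamma b) = (\<integral>\<^sup>+t. ennreal (indicator {0..} t * t powr (b - 1) / exp t) \<partial>lborel)"
    by (rule Gamma_conv_nn_integral_real[OF b])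
  also have "\<dots> = (\<integral>\<^sup>+t. ennreal (if 0 < t then t powr (b - 1) * exp (- t) else 0) \<partial>lborel)"
    by (intro nn_integral_cong_AE AE_I[of _ _ "{0}"])
      (auto simp: indicator_def exp_minus field_simps split: if_splits)
  also have "\<dots> = ennreal \<bar>l\<bar> *
      (\<integral>\<^sup>+t. ennreal (if 0 < 0 + l * t then (0 + l * t) powr (b - 1) * exp (- (0 + l * t)) else 0) \<partial>lborel)"
    using l by (subst nn_integral_real_affine[of _ l 0]) auto
  also have "\<dots> = (\<integral>\<^sup>+t. ennreal (l powr b) *
      ennreal (if 0 < t then t powr (b - 1) * exp (- l * t) else 0) \<partial>lborel)"
    using l by (subst nn_integral_cmult[symmetric])
      (auto intro!: nn_integral_cong simp: zero_less_mult_iff ennreal_mult[symmetric]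
        powr_mult powr_diff)
  also have "\<dots> = ennreal (l powr b) *
     (\<integral>\<^sup>+t. ennreal (if 0 < t then t powr (b - 1) * exp (- l * t) else 0) \<partial>lborel)"
    by (rule nn_integral_cmult) measurable
  finally have *: "ennreal (l powr (- b)) * ennreal (Gamma b) = ennreal (l powr (- b)) *
     (ennreal (l powr b) *
     (\<integral>\<^sup>+t. ennreal (if 0 < t then t powr (b - 1) * exp (- l * t) else 0) \<partial>lborel))" by simp
  have "ennreal (l powr (- b)) * ennreal (l powr b) = 1"
    using l by (simp add: ennreal_mult[symmetric] powr_add[symmetric])
  with * have "(\<integral>\<^sup>+t. ennreal (if 0 < t then t powr (b - 1) * exp (- l * t) else 0) \<partial>lborel) =
      ennreal (l powr (- b)) * ennreal (Gamma b)"
    by (simp only: mult.assoc[symmetric] mult_1)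
  thus ?thesis using Gamma_real_pos[OF b] by (simp add: ennreal_mult mult.commute)
qed

lemma laplace_kern:
  assumes b: "0 < b" and l: "0 < l"
  shows "laplace (kern b) l = ennreal (l powr (- b))"
proof -
  have G: "0 < Gamma b" using b by (rule Gamma_real_pos)
  have "laplace (kern b) l = (\<integral>\<^sup>+t. ennreal (1 / Gamma b) *
      ennreal (if 0 < t then t powr (b - 1) * exp (- l * t) else 0) \<partial>lborel)"
    unfolding laplace_def kern_def
    using G by (intro nn_integral_cong) (auto simp: ennreal_mult[symmetric] mult_ac)
  also have "\<dots> = ennreal (1 / Gamma b) * ennreal (Gamma b * l powr (- b))"
    by (subst nn_integral_cmult) (simp_all only: nn_integral_Gamma[OF b l], measurable)
  also have "\<dots> = ennreal (l powr (- b))"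
    using G by (subst ennreal_mult[symmetric]) auto
  finally show ?thesis .
qed

text \<open>Substituting v = t p leaves Euler's Beta integral. Comparing Laplace transforms would
  give equality almost everywhere only; the pointwise form makes \<open>A_add\<close> an identity of
  functions.\<close>

lemma conv_kern:
  assumes a: "0 < a" and b: "0 < b"
  shows "conv (kern a) (kern b) = kern (a + b)"
proof
  fix t :: real
  have G: "0 < Gamma a" "0 < Gamma b" "0 < Gamma (a + b)" using a b by (auto intro: Gamma_real_pos)
  show "conv (kern a) (kern b) t = kern (a + b) t"
  proof (cases "0 < t")
    case False
    hence "kern a (t - v) * kern b v = 0" for v by (simp add: kern_def)
    hence "conv (kern a) (kern b) t = 0" by (simp only: conv_def nn_integral_const) simp
    thus ?thesis using False by (simp add: kern_def)
  next
    case t: True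
    define C where "C = t powr (a + b - 1) / (Gamma a * Gamma b)"
    have C: "0 < C" using t G by (simp add: C_def)
    have "conv (kern a) (kern b) t =
        ennreal \<bar>t\<bar> * (\<integral>\<^sup>+p. kern a (t - (0 + t * p)) * kern b (0 + t * p) \<partial>lborel)"
      unfolding conv_def using t by (subst nn_integral_real_affine[of _ t 0]) auto
    also have "\<dots> = (\<integral>\<^sup>+p. ennreal t * (kern a (t - t * p) * kern b (t * p)) \<partial>lborel)"
      using t by (subst nn_integral_cmult) auto
    also have "\<dots> = (\<integral>\<^sup>+p. ennreal C *
        ennreal (indicator {0..1} p * (p powr (b - 1) * (1 - p) powr (a - 1))) \<partial>lborel)"
    proof (intro nn_integral_cong_AE AE_I[of _ _ "{0, 1}"] subsetI)
      fix p assume "p \<in> {p \<in> space lborel.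
        ennreal t * (kern a (t - t * p) * kern b (t * p)) \<noteq>
        ennreal C * ennreal (indicator {0..1} p * (p powr (b - 1) * (1 - p) powr (a - 1)))}"
      hence ne: "ennreal t * (kern a (t - t * p) * kern b (t * p)) \<noteq>
        ennreal C * ennreal (indicator {0..1} p * (p powr (b - 1) * (1 - p) powr (a - 1)))" by simp
      show "p \<in> {0, 1}"
      proof (rule ccontr)
        assume "p \<notin> {0, 1}"
        then consider "p < 0" | "1 < p" | "0 < p" "p < 1" by fastforce
        thus False
        proof cases
          case 1
          hence "t * p < 0" using t by (simp add: mult_pos_neg)
          with 1 ne show False by (simp add: kern_def)
        next
          case 2
          hence "t - t * p < 0" using t by simp
          with 2 ne show False by (simp add: kern_def)
        next
          case 3
          have *: "t - t * p = t * (1 - p)" by (simp add: algebra_simps)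
          have pos: "0 < t * p" "0 < t * (1 - p)" using t 3 by auto
          have "t * ((t * (1 - p)) powr (a - 1) / Gamma a * ((t * p) powr (b - 1) / Gamma b)) =
              (t * t powr (a - 1) * t powr (b - 1)) / (Gamma a * Gamma b) *
               (p powr (b - 1) * (1 - p) powr (a - 1))"
            using t 3 by (simp add: powr_mult)
          also have "t * t powr (a - 1) * t powr (b - 1) = t powr (a + b - 1)"
            using t by (simp add: powr_mult_base powr_add[symmetric] algebra_simps)
          finally show False
            using ne t 3 pos G C unfolding * kern_def C_def[symmetric]
            by (simp add: ennreal_mult[symmetric])
        qed
      qed
    qed (auto intro: emeasure_lborel_countable)
    also have "\<dots> = ennreal C * (\<integral>\<^sup>+p. ennreal (indicator {0..1} p *
        (p powr (b - 1) * (1 - p) powr (a - 1))) \<partial>lborel)"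
      by (rule nn_integral_cmult) measurable
    also have "(\<integral>\<^sup>+p. ennreal (indicator {0..1} p *
        (p powr (b - 1) * (1 - p) powr (a - 1))) \<partial>lborel) = ennreal (Beta b a)"
      using has_integral_Beta_real[OF b a]
      by (intro nn_integral_has_integral_lebesgue) auto
    also have "ennreal C * ennreal (Beta b a) = kern (a + b) t"
      using t G C by (auto simp: kern_def Beta_def C_def ennreal_mult[symmetric] add.commute)
    finally show ?thesis .
  qed
qed

text \<open>The quotient of the two kernels is u/b; this is the gain per unit of order in
  \<open>A_step\<close>.\<close>

lemma kern_shift_le:
  assumes b: "0 < b" and ut: "u \<le> t" and t: "0 < t"
  shows "kern (b + 1) u \<le> ennreal (t / b) * kern b u"
proof (cases "0 < u")
  case True
  have G: "0 < Gamma b" "Gamma (b + 1) = b * Gamma b"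
    using b by (auto intro: Gamma_real_pos simp: Gamma_plus1 nonpos_Ints_def)
  have "u powr b / (b * Gamma b) = u / b * (u powr (b - 1) / Gamma b)"
    using True by (simp add: powr_diff)
  also have "\<dots> \<le> t / b * (u powr (b - 1) / Gamma b)"
    using ut b G True by (intro mult_right_mono divide_right_mono) auto
  finally show ?thesis
    using True G b t by (simp add: kern_def ennreal_mult[symmetric])
qed (simp add: kern_def)

section \<open>Elementary estimates for logarithms and Gamma quotients\<close>

text \<open>The concave function 1 + ln x - x has its maximum 0 at 1 only, hence stays below a
  negative constant off any neighbourhood of 1. The slack \<eta> is reserved for the asymptotic
  errors in the domination estimate.\<close>

lemma ln_gap:
  fixes d :: real
  assumes d: "0 < d" "d < 1"
  shows "\<exists>\<kappa>>0. \<exists>\<eta>. 0 < \<eta> \<and> \<eta> < 1 \<and>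
    (\<forall>x>0. d \<le> \<bar>x - 1\<bar> \<longrightarrow> 1 + \<eta> + ln x - (1 - \<eta>) * x \<le> - \<kappa>)"
proof -
  define g where "g a = a - 1 - ln a" for a :: real
  have gpos: "0 < g a" if "0 < a" "a \<noteq> 1" for a
    using that ln_le_minus_one[of a] ln_eq_minus_one[of a] by (fastforce simp: g_def)
  define g0 where "g0 = min (g (1 - d)) (g (1 + d))"
  have g0: "0 < g0" using gpos[of "1 - d"] gpos[of "1 + d"] d by (simp add: g0_def)
  \<comment> \<open>The first bound keeps the slope 1/a - 1 + \<eta> at a = 1 + d nonpositive; the
    second makes the loss \<eta> (1 + a) <= 3 \<eta> at most half of the gap
    \<open>g0\<close>.\<close>
  define \<eta> where "\<eta> = min (d / 2 / (1 + d)) (g0 / 6)"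
  have \<eta>: "0 < \<eta>" "\<eta> \<le> d / 2 / (1 + d)" "\<eta> \<le> g0 / 6"
    using d g0 unfolding \<eta>_def by (auto simp only: min.cobounded1 min.cobounded2) simp
  have "d / 2 / (1 + d) < 1" using d by (simp add: field_simps)
  hence \<eta>1: "\<eta> < 1" using \<eta> by linarith
  \<comment> \<open>The tangent of ln at \<open>a\<close> is used, where \<open>a\<close> will be
    the end point of the excluded interval on the side of \<open>x\<close>.\<close>
  have key: "1 + \<eta> + ln x - (1 - \<eta>) * x \<le> - (g0 / 2)"
    if x: "0 < x" and a: "0 < a" "a \<le> 2" "g0 \<le> g a" and slope: "(1 / a - 1 + \<eta>) * (x - a) \<le> 0" for x a
  proof -
    have "ln x \<le> ln a + x / a - 1"
      using ln_le_minus_one[of "x / a"] x a by (simp add: ln_div)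
    hence "1 + \<eta> + ln x - (1 - \<eta>) * x \<le> \<eta> + ln a + x / a - (1 - \<eta>) * x" by simp
    also have "\<dots> = - g a + \<eta> * (1 + a) + (1 / a - 1 + \<eta>) * (x - a)"
      using a by (simp add: g_def field_simps)
    also have "\<dots> \<le> - g0 + \<eta> * 3"
      using slope a \<eta> mult_left_mono[of "1 + a" 3 \<eta>] by linarith
    also have "\<dots> \<le> - (g0 / 2)" using \<eta> by linarith
    finally show ?thesis .
  qed
  have "1 + \<eta> + ln x - (1 - \<eta>) * x \<le> - (g0 / 2)" if x: "0 < x" "d \<le> \<bar>x - 1\<bar>" for x
  proof (cases "1 < x")
    case True
    show ?thesis
    proof (rule key[of x "1 + d"])
      have "1 / (1 + d) - 1 = - (d / (1 + d))" using d by (simp add: field_simps)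
      moreover have "d / 2 / (1 + d) = d / (1 + d) / 2" by simp
      moreover have "0 \<le> d / (1 + d)" using d by simp
      ultimately have "1 / (1 + d) - 1 + \<eta> \<le> 0" using \<eta> by linarith
      thus "(1 / (1 + d) - 1 + \<eta>) * (x - (1 + d)) \<le> 0"
        using x True by (intro mult_nonpos_nonneg) auto
    qed (use x d in \<open>auto simp: g0_def\<close>)
  next
    case False
    show ?thesis
    proof (rule key[of x "1 - d"])
      have "1 \<le> 1 / (1 - d)" using d by simp
      thus "(1 / (1 - d) - 1 + \<eta>) * (x - (1 - d)) \<le> 0"
        using x False \<eta> by (intro mult_nonneg_nonpos) auto
    qed (use x d in \<open>auto simp: g0_def\<close>)
  qed
  thus ?thesis using g0 \<eta> \<eta>1 by (intro exI[of _ "g0 / 2"] conjI exI[of _ \<eta>]) auto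
qed

text \<open>Log-convexity, with \<open>x\<close> written as the convex combination of x - a and x +
  1 with weights 1/(a+1) and a/(a+1); the functional equation eliminates Gamma(x + 1).\<close>

lemma Gamma_le_powr_mult_Gamma:
  fixes x a :: real
  assumes a: "0 < a" "a < x"
  shows "Gamma x \<le> x powr a * Gamma (x - a)"
proof -
  have G: "0 < Gamma x" "0 < Gamma (x - a)" "0 < Gamma (x + 1)"
    using a by (auto intro: Gamma_real_pos)
  have "(ln \<circ> Gamma) x \<le> 1 / (a + 1) * (ln \<circ> Gamma) (x - a) + a / (a + 1) * (ln \<circ> Gamma) (x + 1)"
  proof -
    have "(1 / (a + 1)) *\<^sub>R (x - a) + (a / (a + 1)) *\<^sub>R (x + 1) = x"
      using a by (simp add: divide_simps) (simp add: algebra_simps)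
    thus ?thesis
      using convex_onD[OF log_convex_Gamma_real, of "a / (a + 1)" "x - a" "x + 1"] a
      by (simp add: field_simps)
  qed
  hence "ln (Gamma x) \<le> (ln (Gamma (x - a)) + a * ln (Gamma (x + 1))) / (a + 1)"
    by (simp add: add_divide_distrib)
  hence "(a + 1) * ln (Gamma x) \<le> ln (Gamma (x - a)) + a * ln (Gamma (x + 1))"
    using a by (subst (asm) pos_le_divide_eq) (auto simp: mult.commute)
  moreover have "ln (Gamma (x + 1)) = ln x + ln (Gamma x)"
  proof -
    have "x \<notin> \<int>\<^sub>\<le>\<^sub>0" using a by (auto elim!: nonpos_Ints_cases)
    hence "Gamma (x + 1) = x * Gamma x" by (rule Gamma_plus1)
    moreover have "Gamma x \<noteq> 0" "x \<noteq> 0" using G(1) a by linarith+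
    ultimately show ?thesis by (simp add: ln_mult)
  qed
  ultimately have "ln (Gamma x) \<le> a * ln x + ln (Gamma (x - a))" by (simp add: algebra_simps)
  also have "\<dots> = ln (x powr a * Gamma (x - a))"
  proof -
    have "Gamma (x - a) \<noteq> 0" "x \<noteq> 0" using G(2) a by linarith+
    thus ?thesis by (simp add: ln_mult ln_powr)
  qed
  finally show ?thesis using G a by simp
qed

text \<open>A single term of the exponential series, used in place of Stirling's formula for n! >=
  (n/e)^n.\<close>

lemma power_self_le_exp_fact: "real n ^ n \<le> exp (real n) * fact n"
proof -
  have "(\<Sum>k\<in>{n}. inverse (fact k) *\<^sub>R real n ^ k) \<le> exp (real n)"
    unfolding exp_def by (intro sum_le_suminf summable_exp_generic) auto
  thus ?thesis by (simp add: field_simps)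
qed

lemma ennreal_mult_assoc:
  "0 \<le> x \<Longrightarrow> 0 \<le> y \<Longrightarrow> ennreal x * (ennreal y * z) = ennreal (x * y) * z"
  by (simp add: ennreal_mult mult.assoc)

lemma Gamma_real_neq_0: "0 < x \<Longrightarrow> Gamma x \<noteq> (0 :: real)"
  using Gamma_real_pos[of x] by linarith

text \<open>The argument is a general sequence \<open>x m\<close> because both \<open>m\<close> and
  \<open>kstar m\<close> will be inserted.\<close>

lemma Gamma_add_asymptotic:
  fixes x :: "nat \<Rightarrow> real"
  assumes x: "filterlim x at_top F"
  shows "((\<lambda>m. Gamma (x m + real k) / (Gamma (x m) * x m ^ k)) \<longlongrightarrow> 1) F"
proof (induction k)
  case 0
  have "\<forall>\<^sub>F m in F. 0 < x m" using x by (simp add: filterlim_at_top_dense)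
  hence "\<forall>\<^sub>F m in F. Gamma (x m + real 0) / (Gamma (x m) * x m ^ 0) = 1"
  proof eventually_elim
    fix m assume "0 < x m"
    hence "Gamma (x m) \<noteq> 0" by (rule Gamma_real_neq_0)
    thus "Gamma (x m + real 0) / (Gamma (x m) * x m ^ 0) = 1" by simp
  qed
  thus ?case by (rule tendsto_eventually)
next
  case (Suc k)
  have "((\<lambda>m. (x m + real k) / x m) \<longlongrightarrow> 1) F"
    by (rule filterlim_compose[OF _ x]) real_asymp
  from tendsto_mult[OF this Suc]
  have "((\<lambda>m. (x m + real k) / x m * (Gamma (x m + real k) / (Gamma (x m) * x m ^ k))) \<longlongrightarrow> 1) F"
    by simp
  moreover have "\<forall>\<^sub>F m in F. 0 < x m" using x by (simp add: filterlim_at_top_dense)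
  hence "\<forall>\<^sub>F m in F. (x m + real k) / x m * (Gamma (x m + real k) / (Gamma (x m) * x m ^ k)) =
      Gamma (x m + real (Suc k)) / (Gamma (x m) * x m ^ Suc k)"
  proof eventually_elim
    fix m assume "0 < x m"
    hence "x m + real k \<notin> \<int>\<^sub>\<le>\<^sub>0" by (auto elim!: nonpos_Ints_cases)
    hence "Gamma (x m + real k + 1) = (x m + real k) * Gamma (x m + real k)" by (rule Gamma_plus1)
    moreover have "x m + real (Suc k) = x m + real k + 1" by simp
    ultimately have "Gamma (x m + real (Suc k)) = (x m + real k) * Gamma (x m + real k)"
      by (simp only:)
    thus "(x m + real k) / x m * (Gamma (x m + real k) / (Gamma (x m) * x m ^ k)) =
      Gamma (x m + real (Suc k)) / (Gamma (x m) * x m ^ Suc k)" by (simp add: mult_ac)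
  qed
  ultimately show ?case by (rule Lim_transform_eventually)
qed

section \<open>Fractional integrals of the stable density\<close>

locale stable_law =
  fixes \<alpha> :: real and f :: "real \<Rightarrow> real"
  assumes \<alpha>_pos: "0 < \<alpha>" and \<alpha>_less_1: "\<alpha> < 1"
    and stable: "stable_density \<alpha> f"
begin

text \<open>\<open>f\<close> is constrained on the positive half-line only; cut off at 0 it is Borel
  measurable and its convolutions are one-sided.\<close>

definition \<phi> :: "real \<Rightarrow> ennreal" where
  "\<phi> t = ennreal (if 0 < t then f t else 0)"

abbreviation A :: "real \<Rightarrow> real \<Rightarrow> ennreal" where
  "A b \<equiv> conv (kern b) \<phi>"

lemma f_nonneg: "0 < t \<Longrightarrow> 0 \<le> f t"
  using stable by (simp add: stable_density_def density_on_pos_def)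

lemma measurable_f0 [measurable]: "(\<lambda>t. if 0 < t then f t else 0) \<in> borel_measurable borel"
proof -
  have "(\<lambda>t. indicator {0<..} t *\<^sub>R f t) \<in> borel_measurable borel"
    using stable by (simp add: stable_density_def density_on_pos_def set_borel_measurable_def)
  also have "(\<lambda>t. indicator {0<..} t *\<^sub>R f t) = (\<lambda>t. if 0 < t then f t else 0)"
    by (auto simp: indicator_def)
  finally show ?thesis .
qed

lemma measurable_\<phi> [measurable]: "\<phi> \<in> borel_measurable borel"
  unfolding \<phi>_def by measurable

lemma \<phi>_eq_0: "t \<le> 0 \<Longrightarrow> \<phi> t = 0" by (simp add: \<phi>_def)

lemma A_eq_0: "t \<le> 0 \<Longrightarrow> A b t = 0"
proof -
  assume "t \<le> 0"
  hence "kern b (t - v) * \<phi> v = 0" for v by (cases "v \<le> 0") (simp_all add: kern_def \<phi>_def)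
  thus ?thesis unfolding conv_def by (simp only: nn_integral_const) simp
qed

lemma laplace_\<phi>: assumes "0 \<le> l" shows "laplace \<phi> l = ennreal (exp (- (l powr \<alpha>)))"
proof -
  have "exp (- (l powr \<alpha>)) = (LINT t:{0<..}|lborel. exp (- l * t) * f t)"
    using stable assms by (simp add: stable_density_def)
  also have "\<dots> = (LINT t|lborel. exp (- l * t) * (if 0 < t then f t else 0))"
    unfolding set_lebesgue_integral_def by (intro Bochner_Integration.integral_cong) auto
  also have "\<dots> = enn2real (\<integral>\<^sup>+t. ennreal (exp (- l * t) * (if 0 < t then f t else 0)) \<partial>lborel)"
    by (rule integral_eq_nn_integral) (auto simp: f_nonneg)
  also have "(\<integral>\<^sup>+t. ennreal (exp (- l * t) * (if 0 < t then f t else 0)) \<partial>lborel) = laplace \<phi> l"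
    unfolding laplace_def \<phi>_def by (intro nn_integral_cong) (simp add: ennreal_mult f_nonneg)
  finally have *: "exp (- (l powr \<alpha>)) = enn2real (laplace \<phi> l)" .
  \<comment> \<open>\<open>enn2real\<close> maps top to 0, and an exponential is never 0.\<close>
  hence "laplace \<phi> l \<noteq> top" by (metis enn2real_top exp_not_eq_zero)
  with * show ?thesis by (simp add: ennreal_enn2real top.not_eq_extremum)
qed

lemma laplace_A: "0 < b \<Longrightarrow> 0 < l \<Longrightarrow> laplace (A b) l = ennreal (l powr (- b) * exp (- (l powr \<alpha>)))"
  by (simp add: laplace_conv laplace_kern laplace_\<phi> ennreal_mult)

lemma integral_\<phi>: "(\<integral>\<^sup>+t. \<phi> t \<partial>lborel) = 1"
  using laplace_\<phi>[of 0] by (simp add: laplace_def)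

text \<open>Both sides, divided by \<open>t\<close>, have the Laplace transform \<open>exp (- l powr \<alpha>)\<close>, because
  \<open>exp (- l * t) / t\<close> is the integral of \<open>exp (- x * t)\<close> over \<open>x \<ge> l\<close>.\<close>

lemma self_convolution: "AE t in lborel. ennreal t * \<phi> t = ennreal \<alpha> * A (1 - \<alpha>) t"
proof -
  define g where "g t = (if 0 < t then ennreal (\<alpha> / t) * A (1 - \<alpha>) t else 0)" for t
  have [measurable]: "g \<in> borel_measurable borel" unfolding g_def by measurable
  have ftc1: "(\<integral>\<^sup>+x. ennreal (exp (- x * t)) * indicator {l..} x \<partial>lborel) =
      ennreal (exp (- l * t) / t)" if t: "0 < t" for t l :: real
  proof -
    have "(\<integral>\<^sup>+x. ennreal (exp (- x * t)) * indicator {l..} x \<partial>lborel) =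
        ennreal (0 - (- exp (- l * t) / t))"
    proof (rule nn_integral_FTC_atLeast)
      show "DERIV (\<lambda>x. - exp (- x * t) / t) x :> exp (- x * t)" for x
        using t by (auto intro!: derivative_eq_intros)
      show "((\<lambda>x. - exp (- x * t) / t) \<longlongrightarrow> 0) at_top"
        using t by real_asymp
    qed auto
    thus ?thesis by simp
  qed
  have laplace_g: "laplace g l = ennreal (exp (- (l powr \<alpha>)))" if l: "0 < l" for l
  proof -
    have "laplace g l = (\<integral>\<^sup>+t. (\<integral>\<^sup>+x. ennreal \<alpha> * (ennreal (exp (- x * t)) * indicator {l..} x * A (1 - \<alpha>) t) \<partial>lborel) \<partial>lborel)"
      unfolding laplace_def
    proof (rule nn_integral_cong)
      fix t
      show "ennreal (exp (- l * t)) * g t = (\<integral>\<^sup>+x. ennreal \<alpha> *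
          (ennreal (exp (- x * t)) * indicator {l..} x * A (1 - \<alpha>) t) \<partial>lborel)"
      proof (cases "0 < t")
        case True
        have "(\<integral>\<^sup>+x. ennreal \<alpha> * (ennreal (exp (- x * t)) * indicator {l..} x * A (1 - \<alpha>) t) \<partial>lborel)
           = ennreal \<alpha> * (ennreal (exp (- l * t) / t) * A (1 - \<alpha>) t)"
          by (simp add: nn_integral_cmult nn_integral_multc ftc1[OF True, simplified])
        also have "\<dots> = ennreal (exp (- l * t)) * g t"
        proof -
          have "ennreal \<alpha> * ennreal (exp (- l * t) / t) = ennreal (exp (- l * t)) * ennreal (\<alpha> / t)"
            using True \<alpha>_pos by (simp add: ennreal_mult[symmetric] mult.commute)
          thus ?thesis using True by (simp add: g_def mult.assoc[symmetric])
        qed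
        finally show ?thesis by simp
      qed (simp add: g_def A_eq_0)
    qed
    also have "\<dots> = (\<integral>\<^sup>+x. (\<integral>\<^sup>+t. ennreal \<alpha> * (ennreal (exp (- x * t)) * indicator {l..} x * A (1 - \<alpha>) t) \<partial>lborel) \<partial>lborel)"
      by (rule lborel_pair.Fubini') measurable
    also have "\<dots> = (\<integral>\<^sup>+x. ennreal (\<alpha> * x powr (\<alpha> - 1) * exp (- (x powr \<alpha>))) * indicator {l..} x \<partial>lborel)"
    proof (rule nn_integral_cong)
      fix x
      show "(\<integral>\<^sup>+t. ennreal \<alpha> * (ennreal (exp (- x * t)) * indicator {l..} x * A (1 - \<alpha>) t) \<partial>lborel) =
        ennreal (\<alpha> * x powr (\<alpha> - 1) * exp (- (x powr \<alpha>))) * indicator {l..} x"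
      proof (cases "l \<le> x")
        case True
        have "(\<integral>\<^sup>+t. ennreal \<alpha> * (ennreal (exp (- x * t)) * indicator {l..} x * A (1 - \<alpha>) t) \<partial>lborel) =
            ennreal \<alpha> * laplace (A (1 - \<alpha>)) x"
          using True unfolding laplace_def by (simp add: nn_integral_cmult)
        also have "\<dots> = ennreal (\<alpha> * x powr (\<alpha> - 1) * exp (- (x powr \<alpha>)))"
          using laplace_A[of "1 - \<alpha>" x] True l \<alpha>_less_1 \<alpha>_pos by (simp add: ennreal_mult[symmetric] mult.assoc)
        finally show ?thesis using True by simp
      qed simp
    qed
    \<comment> \<open>The transform of \<open>A (1 - \<alpha>)\<close> at x is x^(\<alpha> - 1)
      exp(-x^\<alpha>); times \<alpha> it is the derivative of -exp(-x^\<alpha>).\<close>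
    also have "\<dots> = ennreal (0 - (- exp (- (l powr \<alpha>))))"
    proof (rule nn_integral_FTC_atLeast)
      show "DERIV (\<lambda>x. - exp (- (x powr \<alpha>))) x :> \<alpha> * x powr (\<alpha> - 1) * exp (- (x powr \<alpha>))"
        if "l \<le> x" for x
        using that l by (auto intro!: derivative_eq_intros)
      show "((\<lambda>x. - exp (- (x powr \<alpha>))) \<longlongrightarrow> 0) at_top"
        using \<alpha>_pos by real_asymp
    qed (use \<alpha>_pos in auto)
    finally show ?thesis by simp
  qed
  have "AE t in lborel. \<phi> t = g t"
  proof (rule laplace_transform_unique_pos)
    show "(\<integral>\<^sup>+t. ennreal (exp (- t)) * \<phi> t \<partial>lborel) = ennreal (exp (- 1))"
      using laplace_\<phi>[of 1] by (simp add: laplace_def)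
    show "(\<integral>\<^sup>+t. ennreal (exp (- l * t)) * \<phi> t \<partial>lborel) =
        (\<integral>\<^sup>+t. ennreal (exp (- l * t)) * g t \<partial>lborel)" if "0 < l" for l
      using laplace_\<phi>[of l] laplace_g[of l] that by (simp add: laplace_def)
  qed (auto simp: \<phi>_eq_0 g_def)
  thus ?thesis
  proof eventually_elim
    fix t assume eq: "\<phi> t = g t"
    show "ennreal t * \<phi> t = ennreal \<alpha> * A (1 - \<alpha>) t"
    proof (cases "0 < t")
      case True
      thus ?thesis using \<alpha>_pos by (simp add: eq g_def mult.assoc[symmetric] ennreal_mult[symmetric])
    qed (simp add: \<phi>_eq_0 A_eq_0)
  qed
qed

lemma A_add: "0 < a \<Longrightarrow> 0 < b \<Longrightarrow> conv (kern a) (A b) = A (a + b)"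
  by (rule ext) (simp add: conv_assoc conv_kern)

text \<open>Only v < t contributes, so \<open>c\<close> may depend on \<open>t\<close>: factors v or
  v^e inside a convolution are pulled out as t or t^e.\<close>

lemma conv_mono_AE:
  assumes "AE v in lborel. 0 < v \<longrightarrow> v < t \<longrightarrow> x v \<le> c * y v"
    and [measurable]: "y \<in> borel_measurable borel" and z: "\<And>v. v \<le> 0 \<Longrightarrow> x v = 0"
  shows "conv (kern b) x t \<le> c * conv (kern b) y t"
proof -
  have "conv (kern b) x t \<le> (\<integral>\<^sup>+v. c * (kern b (t - v) * y v) \<partial>lborel)"
    unfolding conv_def
  proof (rule nn_integral_mono_AE)
    show "AE v in lborel. kern b (t - v) * x v \<le> c * (kern b (t - v) * y v)"
      using assms(1)
    proof eventually_elim
      fix v assume h: "0 < v \<longrightarrow> v < t \<longrightarrow> x v \<le> c * y v"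
      consider "v \<le> 0" | "t \<le> v" | "0 < v" "v < t" by linarith
      thus "kern b (t - v) * x v \<le> c * (kern b (t - v) * y v)"
      proof cases
        case 3
        hence "kern b (t - v) * x v \<le> kern b (t - v) * (c * y v)"
          using h by (intro mult_left_mono) auto
        thus ?thesis by (simp add: mult_ac)
      qed (simp_all add: z kern_def)
    qed
  qed
  also have "\<dots> = c * conv (kern b) y t"
    unfolding conv_def by (rule nn_integral_cmult) measurable
  finally show ?thesis .
qed

text \<open>Inside a fractional integral, self-convolution replaces A (1 - \<alpha>) v by v
  f(v)/\<alpha>, and v < t. Raising the order by 1 - \<alpha> thus costs t/\<alpha>, whatever the
  order.\<close>

lemma A_up:
  assumes b: "0 < b"
  shows "A (b + (1 - \<alpha>)) t \<le> ennreal (t / \<alpha>) * A b t"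
proof -
  have "conv (kern b) (A (1 - \<alpha>)) t \<le> ennreal (t / \<alpha>) * A b t"
  proof (rule conv_mono_AE)
    show "AE v in lborel. 0 < v \<longrightarrow> v < t \<longrightarrow> A (1 - \<alpha>) v \<le> ennreal (t / \<alpha>) * \<phi> v"
      using self_convolution
    proof eventually_elim
      fix v assume eq: "ennreal v * \<phi> v = ennreal \<alpha> * A (1 - \<alpha>) v"
      show "0 < v \<longrightarrow> v < t \<longrightarrow> A (1 - \<alpha>) v \<le> ennreal (t / \<alpha>) * \<phi> v"
      proof (intro impI)
        assume v: "0 < v" "v < t"
        have "A (1 - \<alpha>) v = ennreal (1 / \<alpha>) * (ennreal \<alpha> * A (1 - \<alpha>) v)"
          using \<alpha>_pos by (simp add: mult.assoc[symmetric] ennreal_mult[symmetric])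
        also have "\<dots> = ennreal (v / \<alpha>) * \<phi> v"
          using \<alpha>_pos v by (simp add: eq[symmetric] mult.assoc[symmetric] ennreal_mult[symmetric])
        also have "\<dots> \<le> ennreal (t / \<alpha>) * \<phi> v"
          using v \<alpha>_pos by (intro mult_right_mono ennreal_leI divide_right_mono) auto
        finally show "A (1 - \<alpha>) v \<le> ennreal (t / \<alpha>) * \<phi> v" .
      qed
    qed
  qed (auto simp: A_eq_0)
  thus ?thesis using b \<alpha>_less_1 by (simp add: A_add)
qed

lemma A_step:
  assumes b: "0 < b" and t: "0 < t"
  shows "A (b + 1) t \<le> ennreal (t / b) * A b t"
proof -
  have "A (b + 1) t \<le> (\<integral>\<^sup>+v. ennreal (t / b) * (kern b (t - v) * \<phi> v) \<partial>lborel)"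
    unfolding conv_def
  proof (rule nn_integral_mono)
    fix v
    show "kern (b + 1) (t - v) * \<phi> v \<le> ennreal (t / b) * (kern b (t - v) * \<phi> v)"
    proof (cases "0 < v")
      case True
      hence "kern (b + 1) (t - v) * \<phi> v \<le> (ennreal (t / b) * kern b (t - v)) * \<phi> v"
        using b t by (intro mult_right_mono kern_shift_le) auto
      thus ?thesis by (simp add: mult.assoc)
    qed (simp add: \<phi>_def)
  qed
  also have "\<dots> = ennreal (t / b) * A b t"
    unfolding conv_def by (rule nn_integral_cmult) measurable
  finally show ?thesis .
qed

section \<open>Distribution function against density near 0\<close>

text \<open>\<open>A 1\<close> is the distribution function F of \<open>f\<close>, so this is the
  differential inequality F <= C v^e F'. A larger \<open>e\<close> is stronger near 0, where the
  decay of a stable density caps it at 1/(1-\<alpha>).\<close>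

definition cdf_bound :: "real \<Rightarrow> real \<Rightarrow> bool" where
  "cdf_bound C e \<longleftrightarrow> 0 < C \<and> 0 \<le> e \<and>
     (AE v in lborel. 0 < v \<longrightarrow> A 1 v \<le> ennreal (C * v powr e) * \<phi> v)"

text \<open>The order b + 1 is reached as \<open>conv (kern b) (A 1)\<close>. The factor C t^e does
  not improve with \<open>b\<close>, unlike t/b in \<open>A_step\<close>, but for e > 1 it is far
  smaller when \<open>t\<close> is tiny.\<close>

lemma A_step_cdf_bound:
  assumes "cdf_bound C e" and b: "0 < b"
  shows "A (b + 1) t \<le> ennreal (C * t powr e) * A b t"
proof -
  have C: "0 < C" "0 \<le> e"
    and ae: "AE v in lborel. 0 < v \<longrightarrow> A 1 v \<le> ennreal (C * v powr e) * \<phi> v"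
    using assms(1) by (auto simp: cdf_bound_def)
  have "conv (kern b) (A 1) t \<le> ennreal (C * t powr e) * A b t"
  proof (rule conv_mono_AE)
    show "AE v in lborel. 0 < v \<longrightarrow> v < t \<longrightarrow> A 1 v \<le> ennreal (C * t powr e) * \<phi> v"
      using ae
    proof eventually_elim
      fix v assume h: "0 < v \<longrightarrow> A 1 v \<le> ennreal (C * v powr e) * \<phi> v"
      show "0 < v \<longrightarrow> v < t \<longrightarrow> A 1 v \<le> ennreal (C * t powr e) * \<phi> v"
      proof (intro impI)
        assume v: "0 < v" "v < t"
        have "A 1 v \<le> ennreal (C * v powr e) * \<phi> v" using h v by simp
        also have "\<dots> \<le> ennreal (C * t powr e) * \<phi> v"
          using v C by (intro mult_right_mono ennreal_leI mult_left_mono powr_mono2) auto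
        finally show "A 1 v \<le> ennreal (C * t powr e) * \<phi> v" .
      qed
    qed
  qed (auto simp: A_eq_0)
  thus ?thesis using b by (simp add: A_add)
qed

lemma A_1: "A 1 t = (\<integral>\<^sup>+v\<in>{..<t}. \<phi> v \<partial>lborel)"
  unfolding conv_def by (intro nn_integral_cong) (auto simp: kern_def indicator_def)

lemma A_1_mono: "s \<le> t \<Longrightarrow> A 1 s \<le> A 1 t"
  unfolding A_1 by (intro nn_integral_mono) (auto simp: indicator_def)

text \<open>Markov's inequality for \<open>exp (- l * t)\<close>, with \<open>l\<close> chosen so that \<open>l * t = 2 * l powr \<alpha>\<close>.\<close>

lemma A_1_lower:
  assumes t: "0 < t"
  shows "ennreal (exp (- 1) / 2 * exp (- ((2 / t) powr (\<alpha> / (1 - \<alpha>))))) \<le> A 1 t"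
proof -
  \<comment> \<open>t <= 2 gives x >= 1, hence exp(-x) <= 1/2, and half of exp(-x) survives the
    subtraction of exp(-2x). Beyond 2 the value at 2 is kept by monotonicity; this is the origin of
    the factor exp(-1).\<close>
  have small: "ennreal (exp (- ((2 / t) powr (\<alpha> / (1 - \<alpha>)))) / 2) \<le> A 1 t"
    if t: "0 < t" "t \<le> 2" for t
  proof -
    define l where "l = (2 / t) powr (1 / (1 - \<alpha>))"
    define x where "x = (2 / t) powr (\<alpha> / (1 - \<alpha>))"
    have l: "0 < l" using t by (simp add: l_def)
    have lx: "l powr \<alpha> = x" by (simp add: l_def x_def powr_powr)
    have "l * t = 2 * x"
    proof -
      have "l = (2 / t) powr (1 + \<alpha> / (1 - \<alpha>))"
        using \<alpha>_less_1 by (simp add: l_def field_simps)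
      also have "\<dots> = 2 / t * x" using t by (simp add: powr_add x_def)
      finally show ?thesis using t by simp
    qed
    have x1: "1 \<le> x" unfolding x_def
      using t \<alpha>_pos \<alpha>_less_1 by (intro ge_one_powr_ge_zero) auto
    have "ennreal (exp (- x)) = laplace \<phi> l" using laplace_\<phi>[of l] l lx by simp
    also have "\<dots> \<le> (\<integral>\<^sup>+v. \<phi> v * indicator {..<t} v + ennreal (exp (- (2 * x))) * \<phi> v \<partial>lborel)"
      unfolding laplace_def
    proof (rule nn_integral_mono)
      fix v
      show "ennreal (exp (- l * v)) * \<phi> v \<le>
          \<phi> v * indicator {..<t} v + ennreal (exp (- (2 * x))) * \<phi> v"
      proof (cases "v < t")
        case True
        have "ennreal (exp (- l * v)) * \<phi> v \<le> 1 * \<phi> v"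
        proof (cases "0 < v")
          case True
          thus ?thesis using l by (intro mult_right_mono) (auto simp flip: ennreal_1)
        qed (simp add: \<phi>_def)
        thus ?thesis using True by (simp add: add_increasing2)
      next
        case False
        hence "l * t \<le> l * v" using l by simp
        hence "exp (- l * v) \<le> exp (- (2 * x))" using \<open>l * t = 2 * x\<close> by simp
        thus ?thesis using False by (auto intro!: mult_right_mono ennreal_leI)
      qed
    qed
    also have "\<dots> = A 1 t + ennreal (exp (- (2 * x)))"
      by (simp add: nn_integral_add nn_integral_cmult integral_\<phi> A_1)
    finally have "ennreal (exp (- x)) - ennreal (exp (- (2 * x))) \<le> A 1 t"
      by (subst ennreal_minus_le_iff) (auto simp: add.commute)
    moreover have "exp (- x) / 2 \<le> exp (- x) - exp (- (2 * x))"
    proof -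
      have "exp (- x) \<le> 1 / 2"
      proof -
        have "2 \<le> exp x" using exp_ge_add_one_self[of x] x1 by linarith
        thus ?thesis by (simp add: exp_minus field_simps)
      qed
      hence "exp (- x) * exp (- x) \<le> exp (- x) * (1 / 2)" by (intro mult_left_mono) auto
      moreover have "exp (- (2 * x)) = exp (- x) * exp (- x)" by (simp add: exp_add[symmetric])
      ultimately show ?thesis by simp
    qed
    ultimately have "ennreal (exp (- x) / 2) \<le> A 1 t"
      by (simp only: ennreal_minus exp_ge_zero) (rule order_trans[OF ennreal_leI])
    thus ?thesis by (simp add: x_def)
  qed
  show ?thesis
  proof (cases "t \<le> 2")
    case True
    have "exp (- 1) / 2 * exp (- ((2 / t) powr (\<alpha> / (1 - \<alpha>)))) \<le>
        exp (- ((2 / t) powr (\<alpha> / (1 - \<alpha>)))) / 2"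
      by (simp add: mult_left_le_one_le)
    thus ?thesis by (rule order_trans[OF ennreal_leI small[OF t True]])
  next
    case False
    have "exp (- 1) / 2 * exp (- ((2 / t) powr (\<alpha> / (1 - \<alpha>)))) \<le> exp (- 1) / (2::real)"
      by simp
    moreover have "ennreal (exp (- 1) / 2) \<le> A 1 2" using small[of 2] by simp
    ultimately have
      "ennreal (exp (- 1) / 2 * exp (- ((2 / t) powr (\<alpha> / (1 - \<alpha>))))) \<le> A 1 2"
      by (rule order_trans[OF ennreal_leI])
    also have "\<dots> \<le> A 1 t" using False by (intro A_1_mono) auto
    finally show ?thesis .
  qed
qed

text \<open>The kernel of order 1 - \<alpha> is decreasing, so on the window it is at least its
  value at distance \<epsilon>.\<close>

lemma A_ge_window:
  assumes e: "0 < \<epsilon>"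
  shows "ennreal (\<epsilon> powr (- \<alpha>) / Gamma (1 - \<alpha>)) * (\<integral>\<^sup>+v\<in>{t - \<epsilon>..<t}. \<phi> v \<partial>lborel) \<le> A (1 - \<alpha>) t"
proof -
  have G: "0 < Gamma (1 - \<alpha>)" using \<alpha>_less_1 by (intro Gamma_real_pos) auto
  have "ennreal (\<epsilon> powr (- \<alpha>) / Gamma (1 - \<alpha>)) * (\<integral>\<^sup>+v\<in>{t - \<epsilon>..<t}. \<phi> v \<partial>lborel) =
      (\<integral>\<^sup>+v. ennreal (\<epsilon> powr (- \<alpha>) / Gamma (1 - \<alpha>)) * (\<phi> v * indicator {t - \<epsilon>..<t} v) \<partial>lborel)"
    by (rule nn_integral_cmult[symmetric]) measurable
  also have "\<dots> \<le> A (1 - \<alpha>) t"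
    unfolding conv_def
  proof (rule nn_integral_mono)
    fix v
    show "ennreal (\<epsilon> powr (- \<alpha>) / Gamma (1 - \<alpha>)) * (\<phi> v * indicator {t - \<epsilon>..<t} v) \<le>
        kern (1 - \<alpha>) (t - v) * \<phi> v"
    proof (cases "v \<in> {t - \<epsilon>..<t}")
      case True
      have "\<epsilon> powr (- \<alpha>) \<le> (t - v) powr (- \<alpha>)"
        using True \<alpha>_pos e by (intro powr_mono2') auto
      hence "ennreal (\<epsilon> powr (- \<alpha>) / Gamma (1 - \<alpha>)) \<le> kern (1 - \<alpha>) (t - v)"
        unfolding kern_def using True G by (auto intro!: ennreal_leI divide_right_mono)
      thus ?thesis using True by (simp add: mult_right_mono)
    qed simp
  qed
  finally show ?thesis .
qed

text \<open>Self-convolution turns mass just below \<open>t\<close> into density at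
  \<open>t\<close>: if at least half of the mass of (0,t) lies in a window of width \<epsilon>, then
  t f(t) is at least a multiple of \<epsilon>^(-\<alpha>) times all of that mass.\<close>

lemma A_1_le_window:
  assumes t: "0 < t" and e: "0 < \<epsilon>"
    and I: "A 1 t \<le> 2 * (\<integral>\<^sup>+v\<in>{t - \<epsilon>..<t}. \<phi> v \<partial>lborel)"
    and sc: "ennreal t * \<phi> t = ennreal \<alpha> * A (1 - \<alpha>) t"
  shows "A 1 t \<le> ennreal (2 * Gamma (1 - \<alpha>) / \<alpha> * \<epsilon> powr \<alpha> * t) * \<phi> t"
proof -
  define G where "G = Gamma (1 - \<alpha>)"
  have G: "0 < G" unfolding G_def using \<alpha>_less_1 by (intro Gamma_real_pos) auto
  define I' where "I' = (\<integral>\<^sup>+v\<in>{t - \<epsilon>..<t}. \<phi> v \<partial>lborel)"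
  have "2 * I' = ennreal (2 * G / \<alpha> * \<epsilon> powr \<alpha>) * (ennreal \<alpha> * (ennreal (\<epsilon> powr (- \<alpha>) / G) * I'))"
  proof -
    have "2 * G / \<alpha> * \<epsilon> powr \<alpha> * (\<alpha> * (\<epsilon> powr (- \<alpha>) / G)) = 2"
      using G \<alpha>_pos e by (simp add: powr_minus field_simps)
    hence "ennreal (2 * G / \<alpha> * \<epsilon> powr \<alpha>) * (ennreal \<alpha> * ennreal (\<epsilon> powr (- \<alpha>) / G)) = ennreal 2"
      using G \<alpha>_pos by (simp only: ennreal_mult[symmetric] powr_ge_zero mult_nonneg_nonneg
          divide_nonneg_pos less_imp_le zero_le_numeral)
    thus ?thesis by (simp add: mult.assoc[symmetric])
  qed
  also have "\<dots> \<le> ennreal (2 * G / \<alpha> * \<epsilon> powr \<alpha>) * (ennreal \<alpha> * A (1 - \<alpha>) t)"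
    using A_ge_window[OF e, of t] unfolding G_def I'_def by (intro mult_left_mono) auto
  also have "\<dots> = ennreal (2 * G / \<alpha> * \<epsilon> powr \<alpha> * t) * \<phi> t"
    using G \<alpha>_pos t by (simp add: sc[symmetric] mult.assoc[symmetric] ennreal_mult[symmetric])
  finally show ?thesis using I by (simp add: I'_def G_def)
qed

text \<open>The window of width \<epsilon> = t contains all the mass below \<open>t\<close>.\<close>

lemma cdf_bound_init: "cdf_bound (2 * Gamma (1 - \<alpha>) / \<alpha>) (1 + \<alpha>)"
proof -
  have G: "0 < Gamma (1 - \<alpha>)" using \<alpha>_less_1 by (intro Gamma_real_pos) auto
  have "AE v in lborel. 0 < v \<longrightarrow> A 1 v \<le> ennreal (2 * Gamma (1 - \<alpha>) / \<alpha> * v powr (1 + \<alpha>)) * \<phi> v"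
    using self_convolution
  proof eventually_elim
    fix t assume sc: "ennreal t * \<phi> t = ennreal \<alpha> * A (1 - \<alpha>) t"
    show "0 < t \<longrightarrow> A 1 t \<le> ennreal (2 * Gamma (1 - \<alpha>) / \<alpha> * t powr (1 + \<alpha>)) * \<phi> t"
    proof
      assume t: "0 < t"
      have "A 1 t = (\<integral>\<^sup>+v\<in>{t - t..<t}. \<phi> v \<partial>lborel)"
        unfolding A_1 by (intro nn_integral_cong) (auto simp: indicator_def \<phi>_def)
      also have "\<dots> \<le> 2 * \<dots>" by (simp add: mult_2)
      finally show "A 1 t \<le> ennreal (2 * Gamma (1 - \<alpha>) / \<alpha> * t powr (1 + \<alpha>)) * \<phi> t"
        using A_1_le_window[OF t t _ sc] t by (simp add: powr_add mult_ac)
    qed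
  qed
  thus ?thesis using G \<alpha>_pos by (simp add: cdf_bound_def)
qed

text \<open>The hypothesis bounds the logarithmic derivative of \<open>A 1\<close> from below, so that at least half
  of the mass on \<open>(0, t)\<close> lies within distance \<open>C * t powr e\<close> of \<open>t\<close>.\<close>

lemma cdf_bound_step:
  assumes "cdf_bound C e"
  shows "cdf_bound (2 * Gamma (1 - \<alpha>) / \<alpha> * C powr \<alpha>) (1 + \<alpha> * e)"
proof -
  have G: "0 < Gamma (1 - \<alpha>)" using \<alpha>_less_1 by (intro Gamma_real_pos) auto
  have C: "0 < C" "0 \<le> e"
    and ae: "AE v in lborel. 0 < v \<longrightarrow> A 1 v \<le> ennreal (C * v powr e) * \<phi> v"
    using assms by (auto simp: cdf_bound_def)
  have "AE t in lborel. 0 < t \<longrightarrow>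
      A 1 t \<le> ennreal (2 * Gamma (1 - \<alpha>) / \<alpha> * C powr \<alpha> * t powr (1 + \<alpha> * e)) * \<phi> t"
    using self_convolution
  proof eventually_elim
    fix t assume sc: "ennreal t * \<phi> t = ennreal \<alpha> * A (1 - \<alpha>) t"
    show "0 < t \<longrightarrow>
      A 1 t \<le> ennreal (2 * Gamma (1 - \<alpha>) / \<alpha> * C powr \<alpha> * t powr (1 + \<alpha> * e)) * \<phi> t"
    proof
      assume t: "0 < t"
      define \<epsilon> where "\<epsilon> = C * t powr e"
      have e: "0 < \<epsilon>" using C t by (simp add: \<epsilon>_def)
      define I where "I = (\<integral>\<^sup>+v\<in>{t - \<epsilon>..<t}. \<phi> v \<partial>lborel)"
      have split: "A 1 t = A 1 (t - \<epsilon>) + I"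
        unfolding A_1 I_def using e
        by (subst nn_integral_add[symmetric]) (auto intro!: nn_integral_cong simp: indicator_def)
      have "A 1 (t - \<epsilon>) \<le> I"
      proof (cases "0 < t - \<epsilon>")
        case True
        \<comment> \<open>On the window, A 1 (t - \<epsilon>) <= A 1 v <= \<epsilon> \<phi>(v);
          integration over its length \<epsilon> cancels that factor.\<close>
        have "ennreal \<epsilon> * A 1 (t - \<epsilon>) = (\<integral>\<^sup>+v. A 1 (t - \<epsilon>) * indicator {t - \<epsilon>..<t} v \<partial>lborel)"
          using e by (subst nn_integral_cmult_indicator) (simp_all add: mult.commute)
        also have "\<dots> \<le> (\<integral>\<^sup>+v. ennreal \<epsilon> * (\<phi> v * indicator {t - \<epsilon>..<t} v) \<partial>lborel)"
        proof (rule nn_integral_mono_AE)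
          show "AE v in lborel. A 1 (t - \<epsilon>) * indicator {t - \<epsilon>..<t} v \<le>
              ennreal \<epsilon> * (\<phi> v * indicator {t - \<epsilon>..<t} v)"
            using ae
          proof eventually_elim
            fix v assume h: "0 < v \<longrightarrow> A 1 v \<le> ennreal (C * v powr e) * \<phi> v"
            show "A 1 (t - \<epsilon>) * indicator {t - \<epsilon>..<t} v \<le>
              ennreal \<epsilon> * (\<phi> v * indicator {t - \<epsilon>..<t} v)"
            proof (cases "v \<in> {t - \<epsilon>..<t}")
              case v: True
              have "A 1 (t - \<epsilon>) \<le> A 1 v" using v by (intro A_1_mono) auto
              also have "\<dots> \<le> ennreal (C * v powr e) * \<phi> v" using h v True by auto
              also have "\<dots> \<le> ennreal \<epsilon> * \<phi> v"
                unfolding \<epsilon>_def using v C True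
                by (intro mult_right_mono ennreal_leI mult_left_mono powr_mono2) auto
              finally show ?thesis using v by simp
            qed simp
          qed
        qed
        also have "\<dots> = ennreal \<epsilon> * I" unfolding I_def by (rule nn_integral_cmult) measurable
        finally show ?thesis using e by (simp add: ennreal_mult_le_mult_iff)
      qed (simp add: A_eq_0)
      hence "A 1 t \<le> 2 * I" unfolding split mult_2 by (rule add_right_mono)
      from A_1_le_window[OF t e this[unfolded I_def] sc]
      have "A 1 t \<le> ennreal (2 * Gamma (1 - \<alpha>) / \<alpha> * \<epsilon> powr \<alpha> * t) * \<phi> t" .
      moreover have "\<epsilon> powr \<alpha> * t = C powr \<alpha> * t powr (1 + \<alpha> * e)"
        using C t by (simp add: \<epsilon>_def powr_mult powr_powr powr_add mult_ac)
      ultimately show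
        "A 1 t \<le> ennreal (2 * Gamma (1 - \<alpha>) / \<alpha> * C powr \<alpha> * t powr (1 + \<alpha> * e)) * \<phi> t"
        by (simp add: mult.assoc)
    qed
  qed
  thus ?thesis using G \<alpha>_pos C by (simp add: cdf_bound_def)
qed

text \<open>The map e -> 1 + \<alpha> e contracts towards its fixed point 1/(1-\<alpha>), and
  \<open>d\<close> is the distance of the initial exponent 1 + \<alpha> from it. The constants
  \<open>C\<close> are uncontrolled along the iteration, but finitely many rounds are
  enough.\<close>

lemma cdf_bound_exists:
  assumes e: "e < 1 / (1 - \<alpha>)"
  shows "\<exists>C e'. e < e' \<and> cdf_bound C e'"
proof -
  define d where "d = \<alpha>\<^sup>2 / (1 - \<alpha>)"
  have ex: "\<exists>C. cdf_bound C (1 / (1 - \<alpha>) - \<alpha> ^ j * d)" for j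
  proof (induction j)
    case 0
    have "1 / (1 - \<alpha>) - d = 1 + \<alpha>"
      using \<alpha>_less_1 by (simp add: d_def field_simps power2_eq_square)
    thus ?case using cdf_bound_init by auto
  next
    case (Suc j)
    then obtain C where "cdf_bound C (1 / (1 - \<alpha>) - \<alpha> ^ j * d)" by blast
    from cdf_bound_step[OF this]
    have "cdf_bound (2 * Gamma (1 - \<alpha>) / \<alpha> * C powr \<alpha>) (1 + \<alpha> * (1 / (1 - \<alpha>) - \<alpha> ^ j * d))" .
    moreover have "1 + \<alpha> * (1 / (1 - \<alpha>) - \<alpha> ^ j * d) = 1 / (1 - \<alpha>) - \<alpha> ^ Suc j * d"
      using \<alpha>_less_1 by (simp add: field_simps)
    ultimately show ?case by metis
  qed
  have "(\<lambda>j. 1 / (1 - \<alpha>) - \<alpha> ^ j * d) \<longlonglongrightarrow> 1 / (1 - \<alpha>) - 0 * d"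
    using \<alpha>_pos \<alpha>_less_1 by (intro tendsto_intros LIMSEQ_power_zero) auto
  hence "\<forall>\<^sub>F j in sequentially. e < 1 / (1 - \<alpha>) - \<alpha> ^ j * d"
    using e by (intro order_tendstoD(1)) auto
  then obtain j where "e < 1 / (1 - \<alpha>) - \<alpha> ^ j * d"
    by (auto simp: eventually_sequentially)
  thus ?thesis using ex[of j] by blast
qed

section \<open>Lower bound for the density, upper bound for its fractional integrals\<close>

text \<open>The initial \<open>cdf_bound\<close> converts the lower estimate of the distribution
  function into one of the density. The factor 2^(\<alpha>/(1-\<alpha>)) in the exponent is not
  sharp; only the power of \<open>t\<close> matters later.\<close>

lemma \<phi>_lower:
  "\<exists>c>0. AE t in lborel. 0 < t \<longrightarrow>
     ennreal (c * t powr (- 1 - \<alpha>) * exp (- ((2 / t) powr (\<alpha> / (1 - \<alpha>))))) \<le> \<phi> t"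
proof -
  define D where "D = 2 * Gamma (1 - \<alpha>) / \<alpha>"
  have D: "0 < D" using \<alpha>_pos \<alpha>_less_1 unfolding D_def by (auto intro!: Gamma_real_pos)
  define E where "E t = exp (- 1) / 2 * exp (- ((2 / t) powr (\<alpha> / (1 - \<alpha>))))" for t
  have "AE t in lborel. 0 < t \<longrightarrow> A 1 t \<le> ennreal (D * t powr (1 + \<alpha>)) * \<phi> t"
    using cdf_bound_init by (simp add: cdf_bound_def D_def)
  hence "AE t in lborel. 0 < t \<longrightarrow>
     ennreal (exp (- 1) / (2 * D) * t powr (- 1 - \<alpha>) * exp (- ((2 / t) powr (\<alpha> / (1 - \<alpha>))))) \<le> \<phi> t"
  proof eventually_elim
    fix t assume h: "0 < t \<longrightarrow> A 1 t \<le> ennreal (D * t powr (1 + \<alpha>)) * \<phi> t"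
    show "0 < t \<longrightarrow> ennreal (exp (- 1) / (2 * D) * t powr (- 1 - \<alpha>) *
        exp (- ((2 / t) powr (\<alpha> / (1 - \<alpha>))))) \<le> \<phi> t"
    proof
      assume t: "0 < t"
      define B where "B = D * t powr (1 + \<alpha>)"
      have B: "0 < B" using D t by (simp add: B_def)
      have "ennreal (E t) \<le> ennreal B * \<phi> t"
        using A_1_lower[OF t] h t by (auto simp: E_def B_def intro: order_trans)
      hence "ennreal (1 / B) * ennreal (E t) \<le> ennreal (1 / B) * (ennreal B * \<phi> t)"
        by (rule mult_left_mono) simp
      also have "\<dots> = \<phi> t" using B by (simp add: mult.assoc[symmetric] ennreal_mult[symmetric])
      also have "ennreal (1 / B) * ennreal (E t) = ennreal (E t / B)"
        using B by (subst ennreal_mult[symmetric]) (simp_all add: E_def)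
      also have "E t / B = exp (- 1) / (2 * D) * t powr (- 1 - \<alpha>) *
          exp (- ((2 / t) powr (\<alpha> / (1 - \<alpha>))))"
        using powr_minus_divide[of t "1 + \<alpha>"] by (simp add: E_def B_def)
      finally show "ennreal (exp (- 1) / (2 * D) * t powr (- 1 - \<alpha>) *
          exp (- ((2 / t) powr (\<alpha> / (1 - \<alpha>))))) \<le> \<phi> t" .
    qed
  qed
  thus ?thesis using D by (intro exI[of _ "exp (- 1) / (2 * D)"]) auto
qed

text \<open>Once the kernel is bounded by an exponential in \<open>v\<close>, what remains is the
  Laplace transform of \<open>f\<close> at (b - 1)/t, which is explicit.\<close>

lemma A_upper:
  assumes b: "1 \<le> b" and t: "0 < t"
  shows "A b t \<le> ennreal (t powr (b - 1) / Gamma b * exp (- (((b - 1) / t) powr \<alpha>)))"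
proof -
  have G: "0 < Gamma b" using b by (intro Gamma_real_pos) auto
  define K where "K = t powr (b - 1) / Gamma b"
  have K: "0 < K" using G t by (simp add: K_def)
  have "A b t \<le> (\<integral>\<^sup>+v. ennreal K * (ennreal (exp (- ((b - 1) / t) * v)) * \<phi> v) \<partial>lborel)"
    unfolding conv_def
  proof (rule nn_integral_mono)
    fix v
    show "kern b (t - v) * \<phi> v \<le> ennreal K * (ennreal (exp (- ((b - 1) / t) * v)) * \<phi> v)"
    proof (cases "0 < v \<and> v < t")
      case True
      have "1 - v / t \<le> exp (- (v / t))" using exp_ge_add_one_self[of "- (v / t)"] by simp
      hence "(1 - v / t) powr (b - 1) \<le> exp (- (v / t)) powr (b - 1)"
        using b True t by (intro powr_mono2) auto
      also have "\<dots> = exp (- ((b - 1) / t) * v)" by (simp add: powr_def)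
      finally have "t powr (b - 1) * (1 - v / t) powr (b - 1) / Gamma b \<le>
          t powr (b - 1) * exp (- ((b - 1) / t) * v) / Gamma b"
        using G by (intro divide_right_mono mult_left_mono) auto
      moreover have "(t - v) powr (b - 1) = t powr (b - 1) * (1 - v / t) powr (b - 1)"
        using t True by (subst powr_mult[symmetric]) (auto simp: right_diff_distrib)
      ultimately have "kern b (t - v) \<le> ennreal (K * exp (- ((b - 1) / t) * v))"
        using True by (auto simp: kern_def K_def intro!: ennreal_leI)
      also have "\<dots> = ennreal K * ennreal (exp (- ((b - 1) / t) * v))"
        using K by (intro ennreal_mult) auto
      finally show ?thesis unfolding mult.assoc[symmetric] by (rule mult_right_mono) simp
    qed (auto simp: kern_def \<phi>_def)
  qed
  also have "\<dots> = ennreal K * laplace \<phi> ((b - 1) / t)"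
    unfolding laplace_def by (rule nn_integral_cmult) measurable
  also have "\<dots> = ennreal (K * exp (- (((b - 1) / t) powr \<alpha>)))"
    using b t K by (subst laplace_\<phi>) (auto simp: ennreal_mult)
  finally show ?thesis by (simp add: K_def)
qed

text \<open>t^(-n) is itself a mixture of the exponentials exp(-l t), with weight l^(n-1)/Gamma(n).
  After Tonelli only the transform of \<open>A\<close> is left, and x = l^\<alpha> makes the
  integral a Gamma integral.\<close>

lemma integral_A:
  fixes n k :: nat
  assumes k: "1 \<le> k" "k \<le> n"
  shows "(\<integral>\<^sup>+t\<in>{0<..}. ennreal (t powr (- real n)) * A (real n - real k * \<alpha>) t \<partial>lborel) =
    ennreal (Gamma (real k) / (\<alpha> * Gamma (real n)))"
proof -
  define b where "b = real n - real k * \<alpha>"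
  have "real k * \<alpha> < real k * 1" using k \<alpha>_less_1 by (intro mult_strict_left_mono) auto
  moreover have "real k \<le> real n" using k by simp
  ultimately have b: "0 < b" unfolding b_def by linarith
  have G: "0 < Gamma (real n)" "0 < Gamma (real k)" using k by (auto intro: Gamma_real_pos)
  define u where "u l = ennreal (if 0 < l then l powr (real n - 1) / Gamma (real n) else 0)" for l
  have [measurable]: "u \<in> borel_measurable borel" unfolding u_def by measurable
  have "(\<integral>\<^sup>+t\<in>{0<..}. ennreal (t powr (- real n)) * A b t \<partial>lborel) =
      (\<integral>\<^sup>+t. (\<integral>\<^sup>+l. u l * (ennreal (exp (- l * t)) * A b t) \<partial>lborel) \<partial>lborel)"
  proof (rule nn_integral_cong)
    fix t
    show "ennreal (t powr (- real n)) * A b t * indicator {0<..} t =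
        (\<integral>\<^sup>+l. u l * (ennreal (exp (- l * t)) * A b t) \<partial>lborel)"
    proof (cases "0 < t")
      case True
      have "(\<integral>\<^sup>+l. u l * (ennreal (exp (- l * t)) * A b t) \<partial>lborel) =
          (\<integral>\<^sup>+l. ennreal (exp (- t * l)) * kern (real n) l \<partial>lborel) * A b t"
        by (subst nn_integral_multc[symmetric])
          (auto intro!: nn_integral_cong simp: u_def kern_def mult_ac)
      also have "(\<integral>\<^sup>+l. ennreal (exp (- t * l)) * kern (real n) l \<partial>lborel) = ennreal (t powr (- real n))"
        using laplace_kern[of "real n" t] k True by (simp add: laplace_def)
      finally show ?thesis using True by simp
    qed (simp add: A_eq_0)
  qed
  also have "\<dots> = (\<integral>\<^sup>+l. (\<integral>\<^sup>+t. u l * (ennreal (exp (- l * t)) * A b t) \<partial>lborel) \<partial>lborel)"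
    by (rule lborel_pair.Fubini') measurable
  also have "\<dots> = (\<integral>\<^sup>+l\<in>{0<..}. ennreal (\<bar>\<alpha>\<bar> * l powr (\<alpha> - 1) *
      ((l powr \<alpha>) powr (real k - 1) * exp (- (l powr \<alpha>)) / (\<alpha> * Gamma (real n)))) \<partial>lborel)"
  proof (rule nn_integral_cong)
    fix l
    show "(\<integral>\<^sup>+t. u l * (ennreal (exp (- l * t)) * A b t) \<partial>lborel) =
      ennreal (\<bar>\<alpha>\<bar> * l powr (\<alpha> - 1) *
      ((l powr \<alpha>) powr (real k - 1) * exp (- (l powr \<alpha>)) / (\<alpha> * Gamma (real n)))) * indicator {0<..} l"
    proof (cases "0 < l")
      case True
      have "(\<integral>\<^sup>+t. u l * (ennreal (exp (- l * t)) * A b t) \<partial>lborel) = u l * laplace (A b) l"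
        unfolding laplace_def by (rule nn_integral_cmult) measurable
      also have "\<dots> = ennreal (l powr (real n - 1) / Gamma (real n) *
          (l powr (- b) * exp (- (l powr \<alpha>))))"
        using True b G by (simp add: u_def laplace_A ennreal_mult[symmetric])
      also have "l powr (real n - 1) / Gamma (real n) * (l powr (- b) * exp (- (l powr \<alpha>))) =
          (l powr (real n - 1) * l powr (- b)) * exp (- (l powr \<alpha>)) / Gamma (real n)" by simp
      also have "l powr (real n - 1) * l powr (- b) = l powr (\<alpha> - 1) * (l powr \<alpha>) powr (real k - 1)"
        by (simp add: powr_powr powr_add[symmetric] b_def algebra_simps)
      finally show ?thesis using True \<alpha>_pos by (simp add: mult.assoc)
    qed (simp add: u_def)
  qed
  also have "\<dots> = (\<integral>\<^sup>+x\<in>{0<..}. ennreal (x powr (real k - 1) * exp (- x) / (\<alpha> * Gamma (real n))) \<partial>lborel)"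
    using \<alpha>_pos G by (intro nn_integral_power_substitution[symmetric]) auto
  also have "\<dots> = (\<integral>\<^sup>+x. ennreal (1 / (\<alpha> * Gamma (real n))) *
      ennreal (if 0 < x then x powr (real k - 1) * exp (- 1 * x) else 0) \<partial>lborel)"
    using \<alpha>_pos G by (intro nn_integral_cong) (auto simp: ennreal_mult[symmetric] indicator_def)
  also have "\<dots> = ennreal (1 / (\<alpha> * Gamma (real n))) * ennreal (Gamma (real k))"
    using nn_integral_Gamma[of "real k" 1] k by (subst nn_integral_cmult) auto
  also have "\<dots> = ennreal (Gamma (real k) / (\<alpha> * Gamma (real n)))"
    using G \<alpha>_pos by (subst ennreal_mult[symmetric]) auto
  finally show ?thesis by (simp add: b_def)
qed

section \<open>The mixing densities of the Gibbs weights\<close>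

text \<open>The law of S^(-1/\<alpha>) when S has density \<open>S_density \<alpha> f n k\<close>;
  \<open>S_expectation_eq\<close> performs this substitution.\<close>

definition mix_density :: "nat \<Rightarrow> nat \<Rightarrow> real \<Rightarrow> ennreal" where
  "mix_density n k t = ennreal (\<alpha> * Gamma (real n) / Gamma (real k) * t powr (- real n)) *
     A (real n - real k * \<alpha>) t"

lemma index_pos:
  assumes "1 \<le> k" "k \<le> n"
  shows "0 < real n - real k * \<alpha>"
proof -
  have "real k * \<alpha> < real k * 1" using assms \<alpha>_less_1 by (intro mult_strict_left_mono) auto
  moreover have "real k \<le> real n" using assms by simp
  ultimately show ?thesis by linarith
qed

lemma integral_mix_density:
  assumes k: "1 \<le> k" "k \<le> n"
  shows "(\<integral>\<^sup>+t\<in>{0<..}. mix_density n k t \<partial>lborel) = 1"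
proof -
  have G: "0 < Gamma (real n)" "0 < Gamma (real k)" using k by (auto intro: Gamma_real_pos)
  have mix: "mix_density n k t = ennreal (\<alpha> * Gamma (real n) / Gamma (real k)) *
      (ennreal (t powr (- real n)) * A (real n - real k * \<alpha>) t)" for t
    unfolding mix_density_def using G \<alpha>_pos by (intro ennreal_mult_assoc[symmetric]) auto
  have "(\<integral>\<^sup>+t\<in>{0<..}. mix_density n k t \<partial>lborel) =
      (\<integral>\<^sup>+t. ennreal (\<alpha> * Gamma (real n) / Gamma (real k)) *
        (ennreal (t powr (- real n)) * A (real n - real k * \<alpha>) t * indicator {0<..} t) \<partial>lborel)"
    by (intro nn_integral_cong) (simp only: mix mult.assoc)
  also have "\<dots> = ennreal (\<alpha> * Gamma (real n) / Gamma (real k)) *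
      ennreal (Gamma (real k) / (\<alpha> * Gamma (real n)))"
    using integral_A[OF k] by (subst nn_integral_cmult) auto
  also have "\<dots> = ennreal (\<alpha> * Gamma (real n) / Gamma (real k) *
      (Gamma (real k) / (\<alpha> * Gamma (real n))))"
    using G \<alpha>_pos by (intro ennreal_mult[symmetric]) auto
  also have "\<alpha> * Gamma (real n) / Gamma (real k) * (Gamma (real k) / (\<alpha> * Gamma (real n))) = 1"
    using G \<alpha>_pos by simp
  finally show ?thesis by simp
qed

section \<open>Domination of the mixing densities by the stable density\<close>

text \<open>\<open>A_up\<close> holds everywhere, so the null set of the self-convolution identity
  serves every \<open>k\<close>. Of the order n - k \<alpha> this settles the part k (1 - \<alpha>)
  and leaves n - k unit steps.\<close>

lemma A_diag_le:
  "AE t in lborel. 0 < t \<longrightarrow> A (real (Suc k) * (1 - \<alpha>)) t \<le> ennreal ((t / \<alpha>) ^ Suc k) * \<phi> t"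
  using self_convolution
proof eventually_elim
  fix t assume sc: "ennreal t * \<phi> t = ennreal \<alpha> * A (1 - \<alpha>) t"
  show "0 < t \<longrightarrow> A (real (Suc k) * (1 - \<alpha>)) t \<le> ennreal ((t / \<alpha>) ^ Suc k) * \<phi> t"
  proof
    assume t: "0 < t"
    show "A (real (Suc k) * (1 - \<alpha>)) t \<le> ennreal ((t / \<alpha>) ^ Suc k) * \<phi> t"
    proof (induction k)
      case 0
      have "A (1 - \<alpha>) t = ennreal (1 / \<alpha>) * (ennreal \<alpha> * A (1 - \<alpha>) t)"
        using \<alpha>_pos by (simp add: mult.assoc[symmetric] ennreal_mult[symmetric])
      also have "\<dots> = ennreal (t / \<alpha>) * \<phi> t"
        using \<alpha>_pos t by (simp add: sc[symmetric] mult.assoc[symmetric] ennreal_mult[symmetric])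
      finally show ?case by simp
    next
      case (Suc k)
      have "A (real (Suc (Suc k)) * (1 - \<alpha>)) t = A (real (Suc k) * (1 - \<alpha>) + (1 - \<alpha>)) t"
        by (simp add: algebra_simps)
      also have "\<dots> \<le> ennreal (t / \<alpha>) * A (real (Suc k) * (1 - \<alpha>)) t"
        using \<alpha>_less_1 by (intro A_up) auto
      also have "\<dots> \<le> ennreal (t / \<alpha>) * (ennreal ((t / \<alpha>) ^ Suc k) * \<phi> t)"
        by (intro mult_left_mono Suc) auto
      also have "\<dots> = ennreal ((t / \<alpha>) * (t / \<alpha>) ^ Suc k) * \<phi> t"
        using t \<alpha>_pos by (intro ennreal_mult_assoc) auto
      also have "(t / \<alpha>) * (t / \<alpha>) ^ Suc k = (t / \<alpha>) ^ Suc (Suc k)" by simp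
      finally show ?case .
    qed
  qed
qed

lemma A_steps_cdf_bound:
  assumes cb: "cdf_bound C e" and b: "0 < b" and t: "0 < t"
  shows "A (b + real j) t \<le> ennreal ((C * t powr e) ^ j) * A b t"
proof (induction j)
  case (Suc j)
  have C: "0 < C" using cb by (simp add: cdf_bound_def)
  have "A (b + real (Suc j)) t = A (b + real j + 1) t" by (simp add: add_ac)
  also have "\<dots> \<le> ennreal (C * t powr e) * A (b + real j) t"
    using b by (intro A_step_cdf_bound[OF cb]) auto
  also have "\<dots> \<le> ennreal (C * t powr e) * (ennreal ((C * t powr e) ^ j) * A b t)"
    by (intro mult_left_mono Suc) auto
  also have "\<dots> = ennreal ((C * t powr e) ^ Suc j) * A b t"
    using C by (simp add: ennreal_mult mult.assoc)
  finally show ?case .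
qed simp

text \<open>Starting above order j + 1, successive factors of \<open>A_step\<close> are at most
  t/(j+1), t/(j+2), and so on, whence the quotient of factorials. The small denominators belong to
  low orders, which is where the steps paid by \<open>cdf_bound\<close> are placed.\<close>

lemma A_steps:
  assumes b: "0 < b" and t: "0 < t"
  shows "A (b + real (Suc j) + real i) t \<le>
    ennreal (t ^ i * fact j / fact (j + i)) * A (b + real (Suc j)) t"
proof (induction i)
  case (Suc i)
  define B where "B = b + real (Suc j) + real i"
  have B: "real (Suc (j + i)) \<le> B" "0 < B" using b by (simp_all add: B_def)
  have "A (b + real (Suc j) + real (Suc i)) t = A (B + 1) t" by (simp add: B_def add_ac)
  also have "\<dots> \<le> ennreal (t / B) * A B t" using B t by (intro A_step) auto
  also have "\<dots> \<le> ennreal (t / real (Suc (j + i))) * A B t"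
    using B t by (intro mult_right_mono ennreal_leI divide_left_mono) auto
  also have "\<dots> \<le> ennreal (t / real (Suc (j + i))) *
      (ennreal (t ^ i * fact j / fact (j + i)) * A (b + real (Suc j)) t)"
    unfolding B_def by (intro mult_left_mono Suc) auto
  also have "\<dots> = ennreal (t / real (Suc (j + i)) * (t ^ i * fact j / fact (j + i))) *
      A (b + real (Suc j)) t"
    using t by (subst ennreal_mult) (auto simp: mult.assoc)
  also have "t / real (Suc (j + i)) * (t ^ i * fact j / fact (j + i)) =
      t ^ Suc i * fact j / fact (j + Suc i)" by simp
  finally show ?case .
qed simp

text \<open>Near \<open>0\<close>: of the \<open>n - k\<close> unit increments of the index, \<open>j\<close> are paid for by \<^term>\<open>cdf_bound\<close>
  and the others by the factorials.\<close>

lemma mix_density_le_near_0: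
  assumes cb: "cdf_bound C e" and k: "1 \<le> k" and j: "1 \<le> j" "k + j \<le> n"
  shows "AE t in lborel. 0 < t \<longrightarrow> mix_density n k t \<le>
    ennreal ((real n / \<alpha>) ^ k * (real j * C * t powr (e - 1)) ^ j) * \<phi> t"
proof -
  obtain k' j' where kj: "k = Suc k'" "j = Suc j'" using k j by (metis Suc_le_D One_nat_def)
  define i where "i = n - k - j"
  have n: "n = k + j + i" using j by (simp add: i_def)
  have C: "0 < C" using cb by (simp add: cdf_bound_def)
  define b where "b = real k * (1 - \<alpha>)"
  have b: "0 < b" using k \<alpha>_less_1 by (simp add: b_def)
  show ?thesis
    using A_diag_le[of k']
  proof eventually_elim
    fix t assume h: "0 < t \<longrightarrow> A (real (Suc k') * (1 - \<alpha>)) t \<le> ennreal ((t / \<alpha>) ^ Suc k') * \<phi> t"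
    show "0 < t \<longrightarrow> mix_density n k t \<le>
      ennreal ((real n / \<alpha>) ^ k * (real j * C * t powr (e - 1)) ^ j) * \<phi> t"
    proof
      assume t: "0 < t"
      define X where "X = C * t powr e"
      have X: "0 < X" using C t by (simp add: X_def)
      \<comment> \<open>The order is k (1 - \<alpha>) + j + i. Peeled from the top, the i steps give
        factorials, the j steps a factor X each, and \<open>A_diag_le\<close> handles the
        rest.\<close>
      have "A (real n - real k * \<alpha>) t = A (b + real j + real i) t"
        by (simp add: n b_def algebra_simps)
      also have "\<dots> \<le> ennreal (t ^ i * fact j' / fact (j' + i)) * A (b + real j) t"
        using A_steps[OF b t, of j' i] by (simp add: kj)
      also have "\<dots> \<le> ennreal (t ^ i * fact j' / fact (j' + i)) * (ennreal (X ^ j) * A b t)"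
        using A_steps_cdf_bound[OF cb b t, of j] by (intro mult_left_mono) (auto simp: X_def)
      also have "\<dots> \<le> ennreal (t ^ i * fact j' / fact (j' + i)) *
          (ennreal (X ^ j) * (ennreal ((t / \<alpha>) ^ k) * \<phi> t))"
        using h t by (intro mult_left_mono) (auto simp: kj b_def)
      also have "\<dots> = ennreal (t ^ i * fact j' / fact (j' + i) * (X ^ j * (t / \<alpha>) ^ k)) * \<phi> t"
        using t X \<alpha>_pos by (simp only: ennreal_mult_assoc mult_nonneg_nonneg divide_nonneg_nonneg
            zero_le_power less_imp_le fact_ge_zero)
      finally have "mix_density n k t \<le>
          ennreal (\<alpha> * Gamma (real n) / Gamma (real k) * t powr (- real n)) *
           (ennreal (t ^ i * fact j' / fact (j' + i) * (X ^ j * (t / \<alpha>) ^ k)) * \<phi> t)"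
        unfolding mix_density_def by (rule mult_left_mono) simp
      also have "\<dots> = ennreal (\<alpha> * Gamma (real n) / Gamma (real k) * t powr (- real n) *
           (t ^ i * fact j' / fact (j' + i) * (X ^ j * (t / \<alpha>) ^ k))) * \<phi> t"
        using t X \<alpha>_pos k j by (subst ennreal_mult)
          (auto simp: mult.assoc intro!: mult_nonneg_nonneg divide_nonneg_nonneg Gamma_real_nonneg)
      also have "\<dots> \<le> ennreal ((real n / \<alpha>) ^ k * (real j * C * t powr (e - 1)) ^ j) * \<phi> t"
      proof (intro mult_right_mono ennreal_leI)
        have nn: "t powr (- real n) = 1 / (t ^ i * t ^ j * t ^ k)"
        proof -
          have "t powr (- real n) = 1 / t ^ n" using t by (simp only: powr_minus_divide powr_realpow)
          thus ?thesis by (simp add: n power_add mult_ac)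
        qed
        have "\<alpha> * Gamma (real n) / Gamma (real k) * t powr (- real n) *
           (t ^ i * fact j' / fact (j' + i) * (X ^ j * (t / \<alpha>) ^ k)) =
          \<alpha> * (Gamma (real n) / fact (j' + i)) * fact j' / Gamma (real k) * ((X / t) ^ j * (1 / \<alpha>) ^ k)"
          using t by (simp add: nn power_divide mult_ac)
        also have "X / t = C * t powr (e - 1)" using t by (simp add: X_def powr_diff)
        \<comment> \<open>Here j' + i = n - k - 1, so Gamma(n)/(j' + i)! is a product of k factors,
          each at most n. The rest is crude: \<alpha> <= 1, j'! <= j^j and Gamma(k) >= 1.\<close>
        also have "\<alpha> * (Gamma (real n) / fact (j' + i)) * fact j' / Gamma (real k) *
             ((C * t powr (e - 1)) ^ j * (1 / \<alpha>) ^ k) \<le>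
            1 * real n ^ k * real j ^ j / 1 * ((C * t powr (e - 1)) ^ j * (1 / \<alpha>) ^ k)"
        proof (intro mult_right_mono mult_mono frac_le)
          have "Gamma (real n) = fact (j' + i + k)"
            using Gamma_fact[of "j' + i + k", where 'a = real] by (simp add: n kj add_ac)
          moreover have "fact (j' + i + m) \<le> real n ^ m * fact (j' + i)" if "m \<le> k" for m
            using that
          proof (induction m)
            case (Suc m)
            have "fact (j' + i + Suc m) = real (j' + i + Suc m) * fact (j' + i + m)" by simp
            also have "\<dots> \<le> real n * (real n ^ m * fact (j' + i))"
              using Suc by (intro mult_mono) (auto simp: n kj)
            finally show ?case by (simp add: mult.assoc)
          qed simp
          ultimately show "Gamma (real n) / fact (j' + i) \<le> real n ^ k"
            by (simp add: divide_le_eq)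
          have "fact j' \<le> real j' ^ j'"
            using fact_le_power[of j', where 'a = real] by simp
          also have "\<dots> \<le> real j ^ j'" by (intro power_mono) (auto simp: kj)
          also have "\<dots> \<le> real j ^ j" by (intro power_increasing) (auto simp: kj)
          finally show "fact j' \<le> real j ^ j" .
          have "Gamma (real k) = fact k'"
            using Gamma_fact[of k', where 'a = real] by (simp add: kj add_ac)
          thus "1 \<le> Gamma (real k)" by simp
        qed (use \<alpha>_pos \<alpha>_less_1 C k j in \<open>auto intro!: mult_nonneg_nonneg Gamma_real_nonneg divide_nonneg_nonneg\<close>)
        also have "\<dots> = (real n / \<alpha>) ^ k * (real j * C * t powr (e - 1)) ^ j"
          by (simp add: power_mult_distrib power_divide mult_ac)
        finally show "\<alpha> * Gamma (real n) / Gamma (real k) * t powr (- real n) *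
           (t ^ i * fact j' / fact (j' + i) * (X ^ j * (t / \<alpha>) ^ k)) \<le>
           (real n / \<alpha>) ^ k * (real j * C * t powr (e - 1)) ^ j" .
      qed simp
      finally show "mix_density n k t \<le>
        ennreal ((real n / \<alpha>) ^ k * (real j * C * t powr (e - 1)) ^ j) * \<phi> t" .
    qed
  qed
qed

text \<open>The quotient of \<open>A_upper\<close> by \<open>\<phi>_lower\<close>, with
  Gamma(n)/Gamma(n - k \<alpha>) <= n^(k \<alpha>). A factor t^(-1-\<alpha>) is spent on
  \<open>f\<close>, which leaves k - 1 factors t^(-\<alpha>). The constant \<open>c\<close> is the
  same for all n and k.\<close>

lemma mix_density_le:
  "\<exists>c>0. \<forall>n k. 1 \<le> k \<longrightarrow> 1 \<le> real n - real k * \<alpha> \<longrightarrow>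
    (AE t in lborel. 0 < t \<longrightarrow> mix_density n k t \<le>
      ennreal (c * real n powr (real k * \<alpha>) / Gamma (real k) * t powr (- (real k - 1) * \<alpha>) *
        exp ((2 / t) powr (\<alpha> / (1 - \<alpha>)) - ((real n - real k * \<alpha> - 1) / t) powr \<alpha>)) * \<phi> t)"
proof -
  obtain c where c: "0 < c" and low: "AE t in lborel. 0 < t \<longrightarrow>
     ennreal (c * t powr (- 1 - \<alpha>) * exp (- ((2 / t) powr (\<alpha> / (1 - \<alpha>))))) \<le> \<phi> t"
    using \<phi>_lower by blast
  show ?thesis
  proof (rule exI[of _ "\<alpha> / c"], intro conjI allI impI)
    fix n k :: nat assume k: "1 \<le> k" and b1: "1 \<le> real n - real k * \<alpha>"
    define b where "b = real n - real k * \<alpha>"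
    have n0: "real k * \<alpha> < real n" using b1 by linarith
    have ka: "0 < real k * \<alpha>" using k \<alpha>_pos by simp
    have n: "0 < real n" using n0 ka by linarith
    have G: "0 < Gamma (real n)" "0 < Gamma (real k)" "0 < Gamma b"
      using b1 n k by (auto intro!: Gamma_real_pos simp: b_def)
    show "AE t in lborel. 0 < t \<longrightarrow> mix_density n k t \<le>
      ennreal (\<alpha> / c * real n powr (real k * \<alpha>) / Gamma (real k) * t powr (- (real k - 1) * \<alpha>) *
        exp ((2 / t) powr (\<alpha> / (1 - \<alpha>)) - ((real n - real k * \<alpha> - 1) / t) powr \<alpha>)) * \<phi> t"
      using low
    proof eventually_elim
      fix t assume h: "0 < t \<longrightarrow>
        ennreal (c * t powr (- 1 - \<alpha>) * exp (- ((2 / t) powr (\<alpha> / (1 - \<alpha>))))) \<le> \<phi> t"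
      show "0 < t \<longrightarrow> mix_density n k t \<le>
        ennreal (\<alpha> / c * real n powr (real k * \<alpha>) / Gamma (real k) * t powr (- (real k - 1) * \<alpha>) *
        exp ((2 / t) powr (\<alpha> / (1 - \<alpha>)) - ((real n - real k * \<alpha> - 1) / t) powr \<alpha>)) * \<phi> t"
      proof
        assume t: "0 < t"
        define x where "x = (2 / t) powr (\<alpha> / (1 - \<alpha>))"
        define y where "y = ((b - 1) / t) powr \<alpha>"
        define R where "R = \<alpha> / c * real n powr (real k * \<alpha>) / Gamma (real k) *
          t powr (- (real k - 1) * \<alpha>) * exp (x - y)"
        have R: "0 \<le> R" unfolding R_def using \<alpha>_pos c G by simp
        have "mix_density n k t \<le>
            ennreal (\<alpha> * Gamma (real n) / Gamma (real k) * t powr (- real n)) *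
            ennreal (t powr (b - 1) / Gamma b * exp (- y))"
          unfolding mix_density_def y_def b_def
          using b1 t by (intro mult_left_mono A_upper) auto
        also have "\<dots> = ennreal (\<alpha> * Gamma (real n) / Gamma (real k) * t powr (- real n) *
            (t powr (b - 1) / Gamma b * exp (- y)))"
          using G \<alpha>_pos by (intro ennreal_mult[symmetric]) auto
        also have "\<dots> \<le> ennreal (R * (c * t powr (- 1 - \<alpha>) * exp (- x)))"
        proof (rule ennreal_leI)
          have "\<alpha> * Gamma (real n) / Gamma (real k) * t powr (- real n) *
              (t powr (b - 1) / Gamma b * exp (- y)) =
            \<alpha> * (Gamma (real n) / Gamma b) / Gamma (real k) *
              (t powr (- real n) * t powr (b - 1)) * exp (- y)" by (simp add: mult_ac)
          also have "t powr (- real n) * t powr (b - 1) =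
              t powr (- (real k - 1) * \<alpha>) * t powr (- 1 - \<alpha>)"
            by (simp add: powr_add[symmetric] b_def algebra_simps)
          also have "\<alpha> * (Gamma (real n) / Gamma b) / Gamma (real k) *
              (t powr (- (real k - 1) * \<alpha>) * t powr (- 1 - \<alpha>)) * exp (- y) \<le>
            \<alpha> * (real n powr (real k * \<alpha>)) / Gamma (real k) *
              (t powr (- (real k - 1) * \<alpha>) * t powr (- 1 - \<alpha>)) * exp (- y)"
            using Gamma_le_powr_mult_Gamma[OF ka n0] G \<alpha>_pos
            by (intro mult_right_mono divide_right_mono mult_left_mono)
              (auto simp: b_def divide_le_eq)
          also have "\<dots> = R * (c * t powr (- 1 - \<alpha>) * exp (- x))"
            using c by (simp add: R_def exp_diff exp_minus field_simps)
          finally show "\<alpha> * Gamma (real n) / Gamma (real k) * t powr (- real n) *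
              (t powr (b - 1) / Gamma b * exp (- y)) \<le> R * (c * t powr (- 1 - \<alpha>) * exp (- x))" .
        qed
        also have "\<dots> = ennreal R * ennreal (c * t powr (- 1 - \<alpha>) * exp (- x))"
          using R c by (intro ennreal_mult) auto
        also have "\<dots> \<le> ennreal R * \<phi> t"
          using h t by (intro mult_left_mono) (auto simp: x_def)
        finally show "mix_density n k t \<le>
          ennreal (\<alpha> / c * real n powr (real k * \<alpha>) / Gamma (real k) * t powr (- (real k - 1) * \<alpha>) *
          exp ((2 / t) powr (\<alpha> / (1 - \<alpha>)) - ((real n - real k * \<alpha> - 1) / t) powr \<alpha>)) * \<phi> t"
          by (simp add: R_def x_def y_def b_def)
      qed
    qed
  qed (use \<alpha>_pos c in simp)
qed

text \<open>With z = t^(-\<alpha>)/s and l = k - 1, the explicit bound is roughly exp(l (1 + ln z -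
  z)), exponentially small in l by \<open>ln_gap\<close> unless z is near 1. It is used where j C
  t^q > 1/2, with j about N^\<theta>; elsewhere \<open>mix_density_le_near_0\<close>
  applies.\<close>

lemma mix_density_domination:
  fixes N K :: "nat \<Rightarrow> nat"
  assumes N: "filterlim (\<lambda>m. real (N m)) at_top sequentially"
    and K: "(\<lambda>m. real (K m) / real (N m) powr \<alpha>) \<longlonglongrightarrow> s" and s: "0 < s"
    and d: "0 < d" "d < 1" and \<epsilon>: "0 < \<epsilon>"
  shows "\<forall>\<^sub>F m in sequentially. AE t in lborel. 0 < t \<longrightarrow> d \<le> \<bar>t powr (- \<alpha>) / s - 1\<bar> \<longrightarrow>
    mix_density (N m) (K m) t \<le> ennreal \<epsilon> * \<phi> t"
proof -
  note \<alpha> = \<alpha>_pos \<alpha>_less_1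
  define r where "r = \<alpha> / (1 - \<alpha>)"
  \<comment> \<open>\<theta> > \<alpha> lets 2^(-N^\<theta>) beat (N/\<alpha>)^K with K of order
    N^\<alpha>; \<theta> < 1 leaves room for an exponent e strictly below 1/(1-\<alpha>).\<close>
  define \<theta> where "\<theta> = (1 + \<alpha>) / 2"
  have \<theta>: "\<alpha> < \<theta>" "\<theta> < 1" "0 < \<theta>" using \<alpha> by (auto simp: \<theta>_def)
  have r: "0 < r" "r - \<alpha> = \<alpha> * r" using \<alpha> by (simp_all add: r_def field_simps)
  obtain \<kappa> \<eta> where \<kappa>: "0 < \<kappa>" and \<eta>: "0 < \<eta>" "\<eta> < 1"
    and gap: "\<And>x. 0 < x \<Longrightarrow> d \<le> \<bar>x - 1\<bar> \<Longrightarrow> 1 + \<eta> + ln x - (1 - \<eta>) * x \<le> - \<kappa>"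
    using ln_gap[OF d] by blast
  obtain c where c: "0 < c" and far: "\<And>n k. 1 \<le> k \<Longrightarrow> 1 \<le> real n - real k * \<alpha> \<Longrightarrow>
    AE t in lborel. 0 < t \<longrightarrow> mix_density n k t \<le>
      ennreal (c * real n powr (real k * \<alpha>) / Gamma (real k) * t powr (- (real k - 1) * \<alpha>) *
        exp ((2 / t) powr r - ((real n - real k * \<alpha> - 1) / t) powr \<alpha>)) * \<phi> t"
    using mix_density_le unfolding r_def by blast
  have "1 + \<theta> * r < 1 / (1 - \<alpha>)"
  proof -
    have "\<theta> * r < 1 * r" using \<theta> r by (intro mult_strict_right_mono) auto
    moreover have "1 / (1 - \<alpha>) = 1 + r" using \<alpha> by (simp add: r_def field_simps)
    ultimately show ?thesis by simp
  qed
  then obtain C e where e: "1 + \<theta> * r < e" and cb: "cdf_bound C e"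
    using cdf_bound_exists by blast
  have C: "0 < C" using cb by (simp add: cdf_bound_def)
  define q where "q = e - 1"
  have q: "\<theta> * r < q" "0 < q" 
  proof -
    have "0 < \<theta> * r" using \<theta>(3) r(1) by (rule mult_pos_pos)
    thus "\<theta> * r < q" "0 < q" using e unfolding q_def by linarith+
  qed
  \<comment> \<open>Where j C t^q > 1/2, t^(-q) = O(N^\<theta>). As q p = \<alpha> r = r - \<alpha>,
    the loss t^(-r) is t^(-\<alpha>) (t^(-q))^p, hence t^(-\<alpha>) O(N^(\<theta> p)); since
    \<theta> p < \<alpha>, it is negligible beside (N/t)^\<alpha>.\<close>
  define p where "p = \<alpha> * r / q"
  have p: "0 < p" "\<theta> * p < \<alpha>" "q * p = \<alpha> * r"
    using q \<alpha> r \<theta> by (simp_all add: p_def field_simps)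
  define X where "X m = real (N m)" for m
  define J where "J m = nat \<lceil>X m powr \<theta>\<rceil>" for m
  \<comment> \<open>The number of factors t^(-\<alpha>) in the explicit bound; also Gamma(K) =
    L!.\<close>
  define L where "L m = real (K m) - 1" for m

  have X: "filterlim X at_top sequentially" using N by (simp add: X_def[abs_def])
  have Xa: "filterlim (\<lambda>m. X m powr \<alpha>) at_top sequentially"
    by (rule filterlim_compose[OF _ X]) (use \<alpha> in real_asymp)
  have Xi: "(\<lambda>m. 1 / X m powr \<alpha>) \<longlonglongrightarrow> 0"
    using tendsto_inverse_0_at_top[OF Xa] by (simp add: inverse_eq_divide)
  have KX: "(\<lambda>m. real (K m) / X m powr \<alpha>) \<longlonglongrightarrow> s" using K by (simp add: X_def)
  have LX: "(\<lambda>m. L m / X m powr \<alpha>) \<longlonglongrightarrow> s"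
    using tendsto_diff[OF KX Xi] by (simp add: L_def diff_divide_distrib)

  have ev0: "\<forall>\<^sub>F m in sequentially. 1 \<le> X m"
    using X by (simp add: filterlim_at_top)
  have ev1: "\<forall>\<^sub>F m in sequentially. real (K m) \<le> 2 * s * X m powr \<alpha>"
  proof -
    have "\<forall>\<^sub>F m in sequentially. real (K m) / X m powr \<alpha> < 2 * s"
      using s by (intro order_tendstoD(2)[OF KX]) auto
    thus ?thesis using ev0 by eventually_elim (simp add: field_simps)
  qed
  have evL: "\<forall>\<^sub>F m in sequentially. s / 2 * X m powr \<alpha> \<le> L m"
  proof -
    have "\<forall>\<^sub>F m in sequentially. s / 2 < L m / X m powr \<alpha>"
      using s by (intro order_tendstoD(1)[OF LX]) auto
    thus ?thesis using ev0 by eventually_elim (simp add: field_simps)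
  qed
  \<comment> \<open>Guarantees k + j <= n, that is, enough unit steps for j of them to be paid by
    \<open>cdf_bound\<close>.\<close>
  have ev2: "\<forall>\<^sub>F m in sequentially. 2 * s * X m powr \<alpha> + X m powr \<theta> + 1 \<le> X m"
  proof -
    have "\<forall>\<^sub>F x in at_top. 2 * s * x powr \<alpha> + x powr \<theta> + 1 \<le> x"
      using \<alpha> \<theta> s by real_asymp
    thus ?thesis using X by (rule eventually_compose_filterlim)
  qed
  \<comment> \<open>The left side bounds the logarithm of (N/\<alpha>)^K 2^(-j).\<close>
  have ev3: "\<forall>\<^sub>F m in sequentially.
      2 * s * X m powr \<alpha> * ln (X m / \<alpha>) - X m powr \<theta> * ln 2 \<le> ln \<epsilon>"
  proof -
    have "filterlim (\<lambda>x. 2 * s * x powr \<alpha> * ln (x / \<alpha>) - x powr \<theta> * ln 2) at_bot at_top"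
      using \<alpha> \<theta> s by real_asymp
    hence "\<forall>\<^sub>F x in at_top. 2 * s * x powr \<alpha> * ln (x / \<alpha>) - x powr \<theta> * ln 2 \<le> ln \<epsilon>"
      by (simp add: filterlim_at_bot)
    thus ?thesis using X by (rule eventually_compose_filterlim)
  qed
  \<comment> \<open>After division by N^\<alpha> everything converges: R = (N - K \<alpha> - 1)/N
    tends to 1, L/N^\<alpha> to s and the correction to 0, so the difference of the two sides tends
    to \<eta> > 0. The premise makes R positive, so that the power of the product splits; it is
    supplied by \<open>b\<close> below.\<close>
  have ev5: "\<forall>\<^sub>F m in sequentially. 0 < (X m - real (K m) * \<alpha> - 1) \<longrightarrow> (1 - \<eta>) * L m / s \<le>
      (X m - real (K m) * \<alpha> - 1) powr \<alpha> - 2 powr r * (4 * C * X m powr \<theta>) powr p"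
  proof -
    define R where "R m = 1 - \<alpha> * (real (K m) / X m powr \<alpha>) * X m powr (\<alpha> - 1) - 1 / X m" for m
    have "(\<lambda>m. X m powr (\<alpha> - 1)) \<longlonglongrightarrow> 0"
      by (rule filterlim_compose[OF _ X]) (use \<alpha> in real_asymp)
    moreover have "(\<lambda>m. 1 / X m) \<longlonglongrightarrow> 0"
      by (rule filterlim_compose[OF _ X]) real_asymp
    ultimately have "R \<longlonglongrightarrow> 1 - \<alpha> * s * 0 - 0"
      unfolding R_def by (intro tendsto_intros KX)
    hence RR: "(\<lambda>m. R m powr \<alpha>) \<longlonglongrightarrow> (1 - \<alpha> * s * 0 - 0) powr \<alpha>"
      by (intro tendsto_powr tendsto_const) auto
    have XX: "(\<lambda>m. X m powr (\<theta> * p - \<alpha>)) \<longlonglongrightarrow> 0"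
      by (rule filterlim_compose[OF _ X]) (use p(2) in real_asymp)
    have "(\<lambda>m. R m powr \<alpha> - 2 powr r * (4 * C) powr p * X m powr (\<theta> * p - \<alpha>) -
        (1 - \<eta>) * (L m / X m powr \<alpha>) / s) \<longlonglongrightarrow>
        (1 - \<alpha> * s * 0 - 0) powr \<alpha> - 2 powr r * (4 * C) powr p * 0 - (1 - \<eta>) * s / s"
      using s by (intro RR XX LX tendsto_diff tendsto_mult tendsto_divide tendsto_const) auto
    moreover have "0 < (1 - \<alpha> * s * 0 - 0) powr \<alpha> - 2 powr r * (4 * C) powr p * 0 - (1 - \<eta>) * s / s"
      using s \<eta> by simp
    ultimately have "\<forall>\<^sub>F m in sequentially. 0 < R m powr \<alpha> -
        2 powr r * (4 * C) powr p * X m powr (\<theta> * p - \<alpha>) - (1 - \<eta>) * (L m / X m powr \<alpha>) / s"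
      by (rule order_tendstoD(1))
    thus ?thesis using ev0
    proof eventually_elim
      fix m assume h: "0 < R m powr \<alpha> - 2 powr r * (4 * C) powr p * X m powr (\<theta> * p - \<alpha>) -
        (1 - \<eta>) * (L m / X m powr \<alpha>) / s" and X1: "1 \<le> X m"
      show "0 < (X m - real (K m) * \<alpha> - 1) \<longrightarrow> (1 - \<eta>) * L m / s \<le>
        (X m - real (K m) * \<alpha> - 1) powr \<alpha> - 2 powr r * (4 * C * X m powr \<theta>) powr p"
      proof
        assume pos: "0 < X m - real (K m) * \<alpha> - 1"
        have XR: "X m - real (K m) * \<alpha> - 1 = X m * R m"
          using X1 by (simp add: R_def powr_diff field_simps)
        hence "0 < R m" using pos X1 by (simp add: zero_less_mult_iff)
        hence 1: "(X m - real (K m) * \<alpha> - 1) powr \<alpha> = X m powr \<alpha> * R m powr \<alpha>"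
          using X1 unfolding XR by (simp add: powr_mult)
        have 2: "(4 * C * X m powr \<theta>) powr p = X m powr \<alpha> * ((4 * C) powr p * X m powr (\<theta> * p - \<alpha>))"
          using X1 C by (simp add: powr_mult powr_powr powr_diff)
        have 3: "(1 - \<eta>) * L m / s = X m powr \<alpha> * ((1 - \<eta>) * (L m / X m powr \<alpha>) / s)"
          using X1 by simp
        have "0 \<le> X m powr \<alpha> * (R m powr \<alpha> - 2 powr r * (4 * C) powr p * X m powr (\<theta> * p - \<alpha>) -
          (1 - \<eta>) * (L m / X m powr \<alpha>) / s)" using h by (intro mult_nonneg_nonneg) auto
        thus "(1 - \<eta>) * L m / s \<le>
          (X m - real (K m) * \<alpha> - 1) powr \<alpha> - 2 powr r * (4 * C * X m powr \<theta>) powr p"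
          unfolding 1 2 3 by (simp only: right_diff_distrib mult_ac)
      qed
    qed
  qed
  \<comment> \<open>Together with l! >= (l/e)^l this bounds (s N^\<alpha>)^l / l! by exp(l (1 +
    \<eta>)).\<close>
  have ev6: "\<forall>\<^sub>F m in sequentially. s * X m powr \<alpha> \<le> exp \<eta> * L m"
  proof -
    have "s / exp \<eta> < s" using s \<eta> by (simp add: divide_less_eq)
    hence "\<forall>\<^sub>F m in sequentially. s / exp \<eta> < L m / X m powr \<alpha>"
      by (intro order_tendstoD(1)[OF LX])
    thus ?thesis using ev0 by eventually_elim (simp add: field_simps)
  qed
  \<comment> \<open>The extra factor N^\<alpha> comes from N^(k \<alpha>) with k = l + 1.\<close>
  have ev7: "\<forall>\<^sub>F m in sequentially. c * X m powr \<alpha> * exp (- \<kappa> * (s / 2 * X m powr \<alpha>)) \<le> \<epsilon>"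
  proof -
    have "((\<lambda>x. c * x powr \<alpha> * exp (- \<kappa> * (s / 2 * x powr \<alpha>))) \<longlongrightarrow> 0) at_top"
      using \<alpha> s \<kappa> by real_asymp
    hence "\<forall>\<^sub>F x in at_top. c * x powr \<alpha> * exp (- \<kappa> * (s / 2 * x powr \<alpha>)) < \<epsilon>"
      using \<epsilon> by (rule order_tendstoD(2))
    from eventually_compose_filterlim[OF this X] show ?thesis
      by eventually_elim simp
  qed
  \<comment> \<open>Combined with \<open>evL\<close> this yields L >= 1, hence k >= 2.\<close>
  have ev8: "\<forall>\<^sub>F m in sequentially. 2 / s \<le> X m powr \<alpha>"
    using Xa by (simp add: filterlim_at_top)

  show ?thesis
    using ev0 ev1 evL ev2 ev3 ev5 ev6 ev7 ev8
  proof eventually_elim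
    fix m
    assume X1: "1 \<le> X m" and h1: "real (K m) \<le> 2 * s * X m powr \<alpha>"
      and hL: "s / 2 * X m powr \<alpha> \<le> L m"
      and h2: "2 * s * X m powr \<alpha> + X m powr \<theta> + 1 \<le> X m"
      and h3: "2 * s * X m powr \<alpha> * ln (X m / \<alpha>) - X m powr \<theta> * ln 2 \<le> ln \<epsilon>"
      and h5: "0 < (X m - real (K m) * \<alpha> - 1) \<longrightarrow> (1 - \<eta>) * L m / s \<le>
        (X m - real (K m) * \<alpha> - 1) powr \<alpha> - 2 powr r * (4 * C * X m powr \<theta>) powr p"
      and h6: "s * X m powr \<alpha> \<le> exp \<eta> * L m"
      and h7: "c * X m powr \<alpha> * exp (- \<kappa> * (s / 2 * X m powr \<alpha>)) \<le> \<epsilon>"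
      and h8: "2 / s \<le> X m powr \<alpha>"
    define k where "k = K m"
    define n where "n = N m"
    define j where "j = J m"
    define x where "x = X m"
    have xn: "x = real n" by (simp add: x_def n_def X_def)
    have x1: "1 \<le> x" using X1 by (simp add: x_def)
    have xt: "1 \<le> x powr \<theta>" using x1 \<theta> by (intro ge_one_powr_ge_zero) auto
    have j: "x powr \<theta> \<le> real j" "real j \<le> x powr \<theta> + 1" "1 \<le> j"
      using xt by (auto simp: j_def J_def x_def) linarith+
    have "1 \<le> s / 2 * x powr \<alpha>" using h8 s by (simp add: x_def field_simps)
    hence L1: "1 \<le> L m" using hL by (simp add: x_def)
    hence k2: "2 \<le> k" by (simp add: L_def k_def)
    define l where "l = k - 1"
    have l: "k = Suc l" "L m = real l" "1 \<le> l" using k2 by (auto simp: l_def L_def k_def)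
    have kj: "real (k + j) \<le> real n"
      using h1 h2 j by (simp add: xn[symmetric] x_def k_def)
    hence kjn: "k + j \<le> n" by (simp only: of_nat_le_iff)
    have "real k * \<alpha> < real k * 1" using k2 \<alpha> by (intro mult_strict_left_mono) auto
    hence b: "0 < real n - real k * \<alpha> - 1" using kj j(3) by simp
    have near: "AE t in lborel. 0 < t \<longrightarrow> mix_density n k t \<le>
        ennreal ((real n / \<alpha>) ^ k * (real j * C * t powr (e - 1)) ^ j) * \<phi> t"
      using kjn j k2 by (intro mix_density_le_near_0[OF cb]) auto
    have "AE t in lborel. 0 < t \<longrightarrow> mix_density n k t \<le>
      ennreal (c * real n powr (real k * \<alpha>) / Gamma (real k) * t powr (- (real k - 1) * \<alpha>) *
        exp ((2 / t) powr r - ((real n - real k * \<alpha> - 1) / t) powr \<alpha>)) * \<phi> t"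
      using k2 b by (intro far) auto
    with near have "AE t in lborel. 0 < t \<longrightarrow> d \<le> \<bar>t powr (- \<alpha>) / s - 1\<bar> \<longrightarrow>
        mix_density n k t \<le> ennreal \<epsilon> * \<phi> t"
    proof eventually_elim
      fix t assume n0: "0 < t \<longrightarrow> mix_density n k t \<le>
          ennreal ((real n / \<alpha>) ^ k * (real j * C * t powr (e - 1)) ^ j) * \<phi> t"
        and f0: "0 < t \<longrightarrow> mix_density n k t \<le>
          ennreal (c * real n powr (real k * \<alpha>) / Gamma (real k) * t powr (- (real k - 1) * \<alpha>) *
          exp ((2 / t) powr r - ((real n - real k * \<alpha> - 1) / t) powr \<alpha>)) * \<phi> t"
      show "0 < t \<longrightarrow> d \<le> \<bar>t powr (- \<alpha>) / s - 1\<bar> \<longrightarrow> mix_density n k t \<le> ennreal \<epsilon> * \<phi> t"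
      proof (intro impI)
        assume t: "0 < t" and dt: "d \<le> \<bar>t powr (- \<alpha>) / s - 1\<bar>"
        show "mix_density n k t \<le> ennreal \<epsilon> * \<phi> t"
        proof (cases "real j * C * t powr q \<le> 1 / 2")
          case True
          have xa: "1 \<le> x / \<alpha>" "0 < x" using x1 \<alpha> by auto
          have "(x / \<alpha>) ^ k * (real j * C * t powr q) ^ j \<le> (x / \<alpha>) ^ k * (1 / 2) ^ j"
            using True C t xa by (intro mult_left_mono power_mono) auto
          also have "\<dots> = exp (real k * ln (x / \<alpha>) - real j * ln 2)"
            using xa \<alpha> by (simp add: exp_diff exp_of_nat_mult power_divide)
          also have "\<dots> \<le> exp (2 * s * x powr \<alpha> * ln (x / \<alpha>) - x powr \<theta> * ln 2)"
          proof -
            have "real k * ln (x / \<alpha>) \<le> 2 * s * x powr \<alpha> * ln (x / \<alpha>)"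
              using h1 xa by (intro mult_right_mono) (auto simp: k_def x_def)
            moreover have "x powr \<theta> * ln 2 \<le> real j * ln 2"
              using j by (intro mult_right_mono) auto
            ultimately show ?thesis unfolding exp_le_cancel_iff by linarith
          qed
          also have "\<dots> \<le> exp (ln \<epsilon>)" using h3 by (simp add: x_def)
          also have "\<dots> = \<epsilon>" using \<epsilon> by simp
          finally have "ennreal ((real n / \<alpha>) ^ k * (real j * C * t powr (e - 1)) ^ j) \<le> ennreal \<epsilon>"
            by (simp add: xn q_def ennreal_leI)
          thus ?thesis using n0 t by (blast intro: order_trans mult_right_mono zero_le)
        next
          case False
          define y where "y = t powr (- \<alpha>)"
          define z where "z = y / s"
          have y: "0 < y" "0 < z" "y = s * z" using t s by (simp_all add: y_def z_def)
          have tq: "t powr (- q) \<le> 4 * C * x powr \<theta>"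
          proof -
            have "1 / 2 < real j * C * t powr q" using False by simp
            hence "t powr (- q) \<le> 2 * (real j * C)" using t by (simp add: powr_minus_divide field_simps)
            also have "\<dots> \<le> 2 * (2 * x powr \<theta> * C)"
              using j xt C by (intro mult_left_mono mult_right_mono) auto
            finally show ?thesis by (simp add: mult_ac)
          qed
          have "(2 / t) powr r = 2 powr r * (y * (t powr (- q)) powr p)"
          proof -
            have "- r = - \<alpha> + (- q) * p" using p(3) r(2) by simp
            hence "t powr (- r) = y * (t powr (- q)) powr p"
              unfolding y_def powr_powr powr_add[symmetric] by simp
            moreover have "(2 / t) powr r = 2 powr r * t powr (- r)"
              using t by (simp add: powr_divide powr_minus_divide)
            ultimately show ?thesis by (simp only:)
          qed
          also have "\<dots> \<le> 2 powr r * (y * (4 * C * x powr \<theta>) powr p)"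
            using tq p y by (intro mult_left_mono powr_mono2) auto
          finally have e1: "(2 / t) powr r \<le> y * (2 powr r * (4 * C * x powr \<theta>) powr p)"
            by (simp add: mult_ac)
          have e2: "((real n - real k * \<alpha> - 1) / t) powr \<alpha> = y * (real n - real k * \<alpha> - 1) powr \<alpha>"
            using b t by (simp add: powr_divide y_def powr_minus_divide)
          \<comment> \<open>Main term and loss now share the factor y = t^(-\<alpha>), so their
            comparison is free of \<open>t\<close> and reduces to \<open>ev5\<close>.\<close>
          have "(1 - \<eta>) * real l / s \<le>
              (real n - real k * \<alpha> - 1) powr \<alpha> - 2 powr r * (4 * C * x powr \<theta>) powr p"
            using h5 b by (simp add: l(2) x_def[symmetric] xn k_def[symmetric])
          hence "y * ((1 - \<eta>) * real l / s) \<le>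
              y * ((real n - real k * \<alpha> - 1) powr \<alpha> - 2 powr r * (4 * C * x powr \<theta>) powr p)"
            using y by (intro mult_left_mono) auto
          hence expo: "(2 / t) powr r - ((real n - real k * \<alpha> - 1) / t) powr \<alpha> \<le>
              - ((1 - \<eta>) * real l * z)"
            using e1 s unfolding e2 right_diff_distrib by (simp add: y(3) mult_ac)
          have xk: "x powr (real k * \<alpha>) = x powr \<alpha> * (x powr \<alpha>) ^ l"
            using x1 by (simp add: l(1) powr_realpow[symmetric] powr_powr powr_add[symmetric] algebra_simps)
          have tk: "t powr (- (real k - 1) * \<alpha>) = (s * z) ^ l"
            using t by (simp add: y(3)[symmetric] y_def l(1) powr_realpow[symmetric] powr_powr mult_ac)
          have Gk: "Gamma (real k) = fact l"
            using Gamma_fact[of l, where 'a = real] by (simp add: l(1) add_ac)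
          have "c * real n powr (real k * \<alpha>) / Gamma (real k) * t powr (- (real k - 1) * \<alpha>) *
              exp ((2 / t) powr r - ((real n - real k * \<alpha> - 1) / t) powr \<alpha>) \<le>
            c * real n powr (real k * \<alpha>) / Gamma (real k) * t powr (- (real k - 1) * \<alpha>) *
              exp (- ((1 - \<eta>) * real l * z))"
            using expo c Gk by (intro mult_left_mono) auto
          also have "\<dots> = c * x powr \<alpha> * ((s * x powr \<alpha>) ^ l * (1 / fact l)) * z ^ l *
              exp (- ((1 - \<eta>) * real l * z))"
            by (simp only: xn[symmetric] xk tk Gk) (simp add: power_mult_distrib mult_ac)
          also have "\<dots> \<le> c * x powr \<alpha> * ((exp \<eta> * real l) ^ l * (exp (real l) / real l ^ l)) *
              z ^ l * exp (- ((1 - \<eta>) * real l * z))"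
          proof -
            have "(s * x powr \<alpha>) ^ l \<le> (exp \<eta> * real l) ^ l"
              using h6 s by (intro power_mono) (auto simp: l x_def)
            moreover have "1 / fact l \<le> exp (real l) / real l ^ l"
              using power_self_le_exp_fact[of l] l(3) by (simp add: field_simps)
            ultimately show ?thesis
              using c y s by (intro mult_right_mono mult_left_mono mult_mono) auto
          qed
          also have "\<dots> = c * x powr \<alpha> * exp (real l * (1 + \<eta> + ln z - (1 - \<eta>) * z))"
          proof -
            have "z ^ l = exp (real l * ln z)" using y by (simp add: exp_of_nat_mult)
            moreover have "exp \<eta> ^ l = exp (real l * \<eta>)" by (simp add: exp_of_nat_mult)
            ultimately have "((exp \<eta> * real l) ^ l * (exp (real l) / real l ^ l)) * z ^ l *
                exp (- ((1 - \<eta>) * real l * z)) =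
                exp (real l * \<eta>) * exp (real l) * exp (real l * ln z) * exp (- ((1 - \<eta>) * real l * z))"
              using l(3) by (simp add: power_mult_distrib)
            also have "\<dots> = exp (real l * (1 + \<eta> + ln z - (1 - \<eta>) * z))"
              by (simp add: exp_add[symmetric] algebra_simps)
            finally show ?thesis by (simp only: mult.assoc)
          qed
          also have "\<dots> \<le> c * x powr \<alpha> * exp (- \<kappa> * (s / 2 * x powr \<alpha>))"
          proof -
            have "real l * (1 + \<eta> + ln z - (1 - \<eta>) * z) \<le> real l * (- \<kappa>)"
              using gap[OF y(2)] dt by (intro mult_left_mono) (auto simp: z_def y_def)
            also have "\<dots> = - \<kappa> * real l" by simp
            also have "\<dots> \<le> - \<kappa> * (s / 2 * x powr \<alpha>)"
              using hL \<kappa> by (simp add: l x_def)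
            finally show ?thesis using c by (intro mult_left_mono) auto
          qed
          also have "\<dots> \<le> \<epsilon>" using h7 by (simp add: x_def)
          finally have "ennreal (c * real n powr (real k * \<alpha>) / Gamma (real k) *
              t powr (- (real k - 1) * \<alpha>) *
              exp ((2 / t) powr r - ((real n - real k * \<alpha> - 1) / t) powr \<alpha>)) \<le> ennreal \<epsilon>"
            by (rule ennreal_leI)
          thus ?thesis using f0 t by (blast intro: order_trans mult_right_mono zero_le)
        qed
      qed
    qed
    thus "AE t in lborel. 0 < t \<longrightarrow> d \<le> \<bar>t powr (- \<alpha>) / s - 1\<bar> \<longrightarrow>
        mix_density (N m) (K m) t \<le> ennreal \<epsilon> * \<phi> t" by (simp add: n_def k_def)
  qed
qed

text \<open>The kernel is positive below \<open>t\<close>, so a zero value would leave no mass on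
  (0,t), contrary to \<open>A_1_lower\<close>.\<close>

lemma A_pos: assumes b: "0 < b" and t: "0 < t" shows "0 < A b t"
proof (rule ccontr)
  assume "\<not> 0 < A b t"
  hence "A b t = 0" by simp
  hence "AE v in lborel. kern b (t - v) * \<phi> v = 0"
    unfolding conv_def by (subst (asm) nn_integral_0_iff_AE) auto
  hence "AE v in lborel. \<phi> v * indicator {..<t} v = 0"
  proof eventually_elim
    fix v assume "kern b (t - v) * \<phi> v = 0"
    moreover have "kern b (t - v) \<noteq> 0" if "v < t"
      using that Gamma_real_pos[OF b] by (simp add: kern_def not_le)
    ultimately show "\<phi> v * indicator {..<t} v = 0" by (auto simp: indicator_def)
  qed
  hence "A 1 t = 0" unfolding A_1 by (subst nn_integral_0_iff_AE) auto
  thus False using A_1_lower[OF t] by (simp add: ennreal_eq_0_iff mult_le_0_iff)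
qed

text \<open>For fixed indices the powers of \<open>t\<close> cancel exactly: n - k unit steps and k
  steps of size 1 - \<alpha> give t^n against t^(-n). This makes the mean of \<open>h\<close> finite
  even when \<open>h\<close> is unbounded.\<close>

lemma mix_density_le_const:
  assumes k: "1 \<le> k" "k \<le> n"
  shows "\<exists>c. AE t in lborel. 0 < t \<longrightarrow> mix_density n k t \<le> ennreal c * \<phi> t"
proof -
  obtain k' where k': "k = Suc k'" using k by (metis Suc_le_D One_nat_def)
  define b where "b = real k * (1 - \<alpha>)"
  have b: "0 < b" using k \<alpha>_less_1 by (simp add: b_def)
  have G: "0 < Gamma (real n)" "0 < Gamma (real k)" using k by (auto intro: Gamma_real_pos)
  have st: "A (b + real j) t \<le> ennreal ((t / b) ^ j) * A b t" if t: "0 < t" for j t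
  proof (induction j)
    case (Suc j)
    have "A (b + real (Suc j)) t = A (b + real j + 1) t" by (simp add: add_ac)
    also have "\<dots> \<le> ennreal (t / (b + real j)) * A (b + real j) t"
      using b t by (intro A_step) auto
    also have "\<dots> \<le> ennreal (t / b) * (ennreal ((t / b) ^ j) * A b t)"
      using b t Suc by (intro mult_mono ennreal_leI divide_left_mono) auto
    also have "\<dots> = ennreal (t / b * (t / b) ^ j) * A b t"
      using b t by (intro ennreal_mult_assoc) auto
    finally show ?case by simp
  qed simp
  define c where "c = \<alpha> * Gamma (real n) / Gamma (real k) * ((1 / b) ^ (n - k) * (1 / \<alpha>) ^ k)"
  have "AE t in lborel. 0 < t \<longrightarrow> mix_density n k t \<le> ennreal c * \<phi> t"
    using A_diag_le[of k']
  proof eventually_elim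
    fix t assume h: "0 < t \<longrightarrow> A (real (Suc k') * (1 - \<alpha>)) t \<le> ennreal ((t / \<alpha>) ^ Suc k') * \<phi> t"
    show "0 < t \<longrightarrow> mix_density n k t \<le> ennreal c * \<phi> t"
    proof
      assume t: "0 < t"
      have "A (real n - real k * \<alpha>) t = A (b + real (n - k)) t"
        using k by (simp add: b_def of_nat_diff algebra_simps)
      also have "\<dots> \<le> ennreal ((t / b) ^ (n - k)) * (ennreal ((t / \<alpha>) ^ k) * \<phi> t)"
        using h t by (intro order_trans[OF st] mult_left_mono) (auto simp: b_def k')
      also have "\<dots> = ennreal ((t / b) ^ (n - k) * (t / \<alpha>) ^ k) * \<phi> t"
        using t b \<alpha>_pos by (intro ennreal_mult_assoc) auto
      finally have "mix_density n k t \<le>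
          ennreal (\<alpha> * Gamma (real n) / Gamma (real k) * t powr (- real n)) *
          (ennreal ((t / b) ^ (n - k) * (t / \<alpha>) ^ k) * \<phi> t)"
        unfolding mix_density_def by (rule mult_left_mono) simp
      also have "\<dots> = ennreal (\<alpha> * Gamma (real n) / Gamma (real k) * t powr (- real n) *
          ((t / b) ^ (n - k) * (t / \<alpha>) ^ k)) * \<phi> t"
        using t b \<alpha>_pos G by (intro ennreal_mult_assoc) auto
      also have "\<alpha> * Gamma (real n) / Gamma (real k) * t powr (- real n) *
          ((t / b) ^ (n - k) * (t / \<alpha>) ^ k) = c"
      proof -
        have "t powr (- real n) = 1 / t ^ n" using t by (simp only: powr_minus_divide powr_realpow)
        moreover have "t ^ n = t ^ (n - k) * t ^ k" using k by (simp add: power_add[symmetric])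
        ultimately show ?thesis using t by (simp add: c_def power_divide)
      qed
      finally show "mix_density n k t \<le> ennreal c * \<phi> t" .
    qed
  qed
  thus ?thesis by blast
qed

lemma measurable_mix_density [measurable]: "mix_density n k \<in> borel_measurable borel"
  unfolding mix_density_def by measurable

lemma mix_density_less_top:
  assumes k: "1 \<le> k" "k \<le> n"
  shows "AE t in lborel. 0 < t \<longrightarrow> mix_density n k t < top"
proof -
  have "AE t in lborel. mix_density n k t * indicator {0<..} t \<noteq> \<infinity>"
    using integral_mix_density[OF k] by (intro nn_integral_PInf_AE) auto
  thus ?thesis by eventually_elim (auto simp: indicator_def top.not_eq_extremum)
qed

text \<open>There is no exceptional set: if \<open>A b t\<close> is infinite, the integral on the
  left and \<open>enn2real\<close> on the right are both 0 by convention.\<close>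

lemma inner_integral:
  assumes b: "0 < b" and t: "0 < t"
  shows "(LINT p:{0<..<1}|lborel. p powr (b - 1) * f ((1 - p) * t)) =
    t powr (- b) * Gamma b * enn2real (A b t)"
proof -
  have G: "0 < Gamma b" using b by (rule Gamma_real_pos)
  define u where "u p = indicator {0<..<1} p * (p powr (b - 1) *
    (if 0 < (1 - p) * t then f ((1 - p) * t) else 0))" for p :: real
  have [measurable]: "u \<in> borel_measurable borel"
  proof -
    have "(\<lambda>p. (\<lambda>x. if 0 < x then f x else 0) ((1 - p) * t)) \<in> borel_measurable borel"
      by (rule measurable_compose[OF _ measurable_f0]) measurable
    thus ?thesis unfolding u_def by measurable
  qed
  have "(LINT p:{0<..<1}|lborel. p powr (b - 1) * f ((1 - p) * t)) = (LINT p|lborel. u p)"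
    unfolding set_lebesgue_integral_def using t
    by (intro Bochner_Integration.integral_cong) (auto simp: u_def indicator_def)
  also have "\<dots> = enn2real (\<integral>\<^sup>+p. ennreal (u p) \<partial>lborel)"
    by (rule integral_eq_nn_integral) (auto simp: u_def f_nonneg)
  finally have *: "(LINT p:{0<..<1}|lborel. p powr (b - 1) * f ((1 - p) * t)) =
      enn2real (\<integral>\<^sup>+p. ennreal (u p) \<partial>lborel)" .
  \<comment> \<open>v = t - t p reverses orientation, so that the kernel receives t p and
    \<open>\<phi>\<close> receives (1 - p) t.\<close>
  have "A b t = ennreal \<bar>- t\<bar> * (\<integral>\<^sup>+p. kern b (t - (t + - t * p)) * \<phi> (t + - t * p) \<partial>lborel)"
    unfolding conv_def using t by (intro nn_integral_real_affine) auto
  also have "\<dots> = (\<integral>\<^sup>+p. ennreal t * (kern b (t * p) * \<phi> ((1 - p) * t)) \<partial>lborel)"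
    using t by (subst nn_integral_cmult) (auto simp: algebra_simps)
  also have "\<dots> = (\<integral>\<^sup>+p. ennreal (t powr b / Gamma b) * ennreal (u p) \<partial>lborel)"
  proof (rule nn_integral_cong)
    fix p
    show "ennreal t * (kern b (t * p) * \<phi> ((1 - p) * t)) =
        ennreal (t powr b / Gamma b) * ennreal (u p)"
    proof (cases "0 < p \<and> p < 1")
      case True
      hence p: "0 < t * p" "0 < (1 - p) * t" using t by auto
      have "t * ((t * p) powr (b - 1) / Gamma b * f ((1 - p) * t)) =
          t powr b / Gamma b * (p powr (b - 1) * f ((1 - p) * t))"
        using t True by (simp add: powr_mult powr_diff)
      thus ?thesis
        using p True t G f_nonneg[OF p(2)]
        by (simp add: kern_def \<phi>_def u_def ennreal_mult[symmetric])
    next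
      case False
      have "\<not> 0 < t * p \<or> \<not> 0 < (1 - p) * t" using False t by (auto simp: zero_less_mult_iff)
      thus ?thesis using False by (auto simp: kern_def \<phi>_def u_def indicator_def)
    qed
  qed
  also have "\<dots> = ennreal (t powr b / Gamma b) * (\<integral>\<^sup>+p. ennreal (u p) \<partial>lborel)"
    by (rule nn_integral_cmult) measurable
  finally have "enn2real (A b t) = t powr b / Gamma b * enn2real (\<integral>\<^sup>+p. ennreal (u p) \<partial>lborel)"
    using G t by (simp add: enn2real_mult)
  thus ?thesis unfolding * using G t by (simp add: powr_minus_divide)
qed

end

section \<open>Convergence of the mixture means\<close>

locale stable_mixture = stable_law +
  fixes h :: "real \<Rightarrow> real"
  assumes h_meas: "set_borel_measurable lborel {0<..} h"
    and h_nonneg: "\<And>t. 0 < t \<Longrightarrow> 0 \<le> h t"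
    and h_density: "density_on_pos (\<lambda>t. h t * f t)"
begin

definition h0 :: "real \<Rightarrow> real" where "h0 t = (if 0 < t then h t else 0)"

lemma h0_nonneg: "0 \<le> h0 t" by (simp add: h0_def h_nonneg)

lemma measurable_h0 [measurable]: "h0 \<in> borel_measurable borel"
proof -
  have "(\<lambda>t. indicator {0<..} t *\<^sub>R h t) \<in> borel_measurable borel"
    using h_meas by (simp add: set_borel_measurable_def)
  also have "(\<lambda>t. indicator {0<..} t *\<^sub>R h t) = h0" by (auto simp: indicator_def h0_def)
  finally show ?thesis .
qed

lemma integral_h\<phi>: "(\<integral>\<^sup>+t. ennreal (h0 t) * \<phi> t \<partial>lborel) = 1"
proof -
  have "1 = (LINT t:{0<..}|lborel. h t * f t)"
    using h_density by (simp add: density_on_pos_def)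
  also have "\<dots> = (LINT t|lborel. h0 t * (if 0 < t then f t else 0))"
    unfolding set_lebesgue_integral_def
    by (intro Bochner_Integration.integral_cong) (auto simp: h0_def)
  also have "\<dots> = enn2real (\<integral>\<^sup>+t. ennreal (h0 t * (if 0 < t then f t else 0)) \<partial>lborel)"
    by (rule integral_eq_nn_integral) (auto simp: h0_nonneg f_nonneg)
  also have "(\<integral>\<^sup>+t. ennreal (h0 t * (if 0 < t then f t else 0)) \<partial>lborel) =
      (\<integral>\<^sup>+t. ennreal (h0 t) * \<phi> t \<partial>lborel)"
    unfolding \<phi>_def by (intro nn_integral_cong ennreal_mult) (auto simp: h0_nonneg f_nonneg)
  finally have *: "enn2real (\<integral>\<^sup>+t. ennreal (h0 t) * \<phi> t \<partial>lborel) = 1" by simp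
  hence "(\<integral>\<^sup>+t. ennreal (h0 t) * \<phi> t \<partial>lborel) \<noteq> top" by (metis enn2real_top zero_neq_one)
  thus ?thesis using * by (metis ennreal_1 ennreal_enn2real top.not_eq_extremum)
qed

definition mix_mean :: "nat \<Rightarrow> nat \<Rightarrow> ennreal" where
  "mix_mean n k = (\<integral>\<^sup>+t. ennreal (h0 t) * mix_density n k t \<partial>lborel)"

text \<open>The mixing density may be infinite on a null set; the real-valued form is the one that
  the integrals defining the weights and the expectation produce.\<close>

lemma mix_mean_eq:
  assumes k: "1 \<le> k" "k \<le> n"
  shows "mix_mean n k = (\<integral>\<^sup>+t\<in>{0<..}. ennreal (h0 t * enn2real (mix_density n k t)) \<partial>lborel)"
  unfolding mix_mean_def
proof (rule nn_integral_cong_AE)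
  show "AE t in lborel. ennreal (h0 t) * mix_density n k t =
      ennreal (h0 t * enn2real (mix_density n k t)) * indicator {0<..} t"
    using mix_density_less_top[OF k]
    by eventually_elim (auto simp: h0_def indicator_def ennreal_mult h_nonneg)
qed

lemma mix_mean_less_top:
  assumes k: "1 \<le> k" "k \<le> n"
  shows "mix_mean n k < top"
proof -
  obtain c where c: "AE t in lborel. 0 < t \<longrightarrow> mix_density n k t \<le> ennreal c * \<phi> t"
    using mix_density_le_const[OF k] by blast
  have "mix_mean n k \<le> (\<integral>\<^sup>+t. ennreal c * (ennreal (h0 t) * \<phi> t) \<partial>lborel)"
    unfolding mix_mean_def
  proof (rule nn_integral_mono_AE)
    show "AE t in lborel. ennreal (h0 t) * mix_density n k t \<le> ennreal c * (ennreal (h0 t) * \<phi> t)"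
      using c
    proof eventually_elim
      fix t assume h: "0 < t \<longrightarrow> mix_density n k t \<le> ennreal c * \<phi> t"
      show "ennreal (h0 t) * mix_density n k t \<le> ennreal c * (ennreal (h0 t) * \<phi> t)"
      proof (cases "0 < t")
        case True
        hence "ennreal (h0 t) * mix_density n k t \<le> ennreal (h0 t) * (ennreal c * \<phi> t)"
          using h by (intro mult_left_mono) auto
        thus ?thesis by (simp add: mult_ac)
      qed (simp add: h0_def)
    qed
  qed
  also have "\<dots> = ennreal c" by (simp add: nn_integral_cmult integral_h\<phi>)
  finally show ?thesis by (rule order_le_less_trans) simp
qed

text \<open>Keeps the denominators of the theorem nonzero. The mixing density is positive on the
  whole half-line, so a vanishing mean would force h = 0 almost everywhere there, against continuity
  and positivity at \<open>t0\<close>.\<close>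

lemma mix_mean_pos:
  assumes k: "1 \<le> k" "k \<le> n" and t0: "0 < t0" and ht0: "isCont h t0" "0 < h t0"
  shows "0 < mix_mean n k"
proof (rule ccontr)
  assume "\<not> 0 < mix_mean n k"
  hence "mix_mean n k = 0" by simp
  hence "AE t in lborel. ennreal (h0 t) * mix_density n k t = 0"
    unfolding mix_mean_def by (subst (asm) nn_integral_0_iff_AE) auto
  hence ae: "AE t in lborel. \<not> (0 < t \<and> 0 < h t)"
  proof eventually_elim
    fix t assume z: "ennreal (h0 t) * mix_density n k t = 0"
    have "0 < mix_density n k t" if "0 < t"
      unfolding mix_density_def
      using that k A_pos[OF index_pos[OF k] that] \<alpha>_pos
      by (auto simp: ennreal_zero_less_mult_iff intro!: mult_pos_pos divide_pos_pos Gamma_real_pos)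
    thus "\<not> (0 < t \<and> 0 < h t)" using z by (auto simp: h0_def)
  qed
  have "(h \<longlongrightarrow> h t0) (nhds t0)"
    using ht0(1) by (simp add: isCont_def tendsto_at_iff_tendsto_nhds)
  hence "\<forall>\<^sub>F t in nhds t0. 0 < h t" using ht0(2) by (rule order_tendstoD(1))
  moreover have "\<forall>\<^sub>F t in nhds t0. t \<in> {0<..}" using t0 by (intro eventually_nhds_in_open) auto
  ultimately have "\<forall>\<^sub>F t in nhds t0. 0 < h t \<and> 0 < t" by eventually_elim simp
  then obtain e where e: "0 < e" "\<And>t. dist t t0 < e \<Longrightarrow> 0 < h t \<and> 0 < t"
    by (auto simp: eventually_nhds_metric)
  have "AE t in lborel. t \<notin> ball t0 e"
    using ae by eventually_elim (use e in \<open>auto simp: dist_commute\<close>)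
  hence "emeasure lborel (ball t0 e) = 0"
    by (subst (asm) AE_iff_measurable[of "ball t0 e"]) auto
  moreover have "ball t0 e = {t0 - e<..<t0 + e}" by (auto simp: dist_real_def)
  ultimately show False using e by (simp add: ennreal_eq_0_iff)
qed

section \<open>Gibbs weights and expectations as mixture means\<close>

text \<open>One factor \<alpha> sits in \<open>mix_density\<close>, whence the exponent k - 1.
  Together with \<open>S_expectation_eq\<close> this relates weight and expectation, as the second
  equality of the theorem requires.\<close>

lemma gibbs_V_eq:
  assumes k: "1 \<le> k" "k \<le> n"
  shows "gibbs_V \<alpha> f h n k =
    \<alpha> ^ (k - 1) * Gamma (real k) / Gamma (real n) * enn2real (mix_mean n k)"
proof -
  define b where "b = real n - real k * \<alpha>"
  have b: "0 < b" using index_pos[OF k] by (simp add: b_def)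
  have G: "Gamma (real n) \<noteq> 0" "Gamma (real k) \<noteq> 0" "Gamma b \<noteq> 0"
    using k b by (intro Gamma_real_neq_0; simp)+
  define u where "u t = indicator {0<..} t * (h0 t * enn2real (mix_density n k t))" for t :: real
  have [measurable]: "u \<in> borel_measurable borel" unfolding u_def by measurable
  have "gibbs_V \<alpha> f h n k =
      (LINT t|lborel. \<alpha> ^ (k - 1) * Gamma (real k) / Gamma (real n) * u t)"
    unfolding gibbs_V_def set_lebesgue_integral_def
  proof (intro Bochner_Integration.integral_cong refl)
    fix t :: real
    show "indicator {0<..} t *\<^sub>R (\<alpha> ^ k / Gamma (real n - real k * \<alpha>) * t powr (- real k * \<alpha>) *
         (LINT p|lborel. indicator {0<..<1} p *\<^sub>R (p powr (real n - 1 - real k * \<alpha>) * f ((1 - p) * t))) * h t) =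
       \<alpha> ^ (k - 1) * Gamma (real k) / Gamma (real n) * u t"
    proof (cases "0 < t")
      case True
      have "real n - 1 - real k * \<alpha> = b - 1" by (simp add: b_def)
      hence inner: "(LINT p|lborel. indicator {0<..<1} p *\<^sub>R
          (p powr (real n - 1 - real k * \<alpha>) * f ((1 - p) * t))) =
          t powr (- b) * Gamma b * enn2real (A b t)"
        using inner_integral[OF b True] by (simp only: set_lebesgue_integral_def)
      have mix: "enn2real (mix_density n k t) =
          \<alpha> * Gamma (real n) / Gamma (real k) * t powr (- real n) * enn2real (A b t)"
        using k \<alpha>_pos by (simp add: mix_density_def enn2real_mult b_def Gamma_real_nonneg)
      have tn: "t powr (- real k * \<alpha>) * t powr (- b) = t powr (- real n)"
        by (simp add: powr_add[symmetric] b_def)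
      have ak: "\<alpha> ^ k = \<alpha> ^ (k - 1) * \<alpha>" using k by (metis One_nat_def Suc_pred' power_Suc2 less_eq_Suc_le)
      show ?thesis
        using True G
        by (simp only: inner mix u_def b_def[symmetric] tn[symmetric] ak) (simp add: h0_def mult_ac)
    qed (simp add: u_def)
  qed
  also have "\<dots> = \<alpha> ^ (k - 1) * Gamma (real k) / Gamma (real n) * (LINT t|lborel. u t)" by simp
  also have "(LINT t|lborel. u t) = enn2real (\<integral>\<^sup>+t. ennreal (u t) \<partial>lborel)"
    by (rule integral_eq_nn_integral) (auto simp: u_def h0_nonneg)
  also have "(\<integral>\<^sup>+t. ennreal (u t) \<partial>lborel) = mix_mean n k"
    unfolding mix_mean_eq[OF k] by (intro nn_integral_cong) (auto simp: u_def indicator_def)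
  finally show ?thesis .
qed

text \<open>Under t = x^(-1/\<alpha>) the Jacobian is x^(-1/\<alpha> - 1)/\<alpha>, and the
  remaining x^k = t^(-k \<alpha>) turns t^(-b) into t^(-n).\<close>

lemma S_expectation_eq:
  assumes k: "1 \<le> k" "k \<le> n"
  shows "S_expectation \<alpha> f n k (\<lambda>x. h (x powr (- 1 / \<alpha>))) = enn2real (mix_mean n k)"
proof -
  define b where "b = real n - real k * \<alpha>"
  have b: "0 < b" using index_pos[OF k] by (simp add: b_def)
  have G: "Gamma (real n) \<noteq> 0" "Gamma (real k) \<noteq> 0" "Gamma b \<noteq> 0"
    using k b by (intro Gamma_real_neq_0; simp)+
  define H where "H t = h0 t * enn2real (mix_density n k t)" for t
  have [measurable]: "H \<in> borel_measurable borel" unfolding H_def by measurable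
  define u where "u x = indicator {0<..} x *
    (\<bar>- 1 / \<alpha>\<bar> * x powr (- 1 / \<alpha> - 1) * H (x powr (- 1 / \<alpha>)))" for x :: real
  have [measurable]: "u \<in> borel_measurable borel" unfolding u_def by measurable
  have "S_expectation \<alpha> f n k (\<lambda>x. h (x powr (- 1 / \<alpha>))) = (LINT x|lborel. u x)"
    unfolding S_expectation_def S_density_def set_lebesgue_integral_def
  proof (intro Bochner_Integration.integral_cong refl)
    fix x :: real
    show "indicator {0<..} x *\<^sub>R (h (x powr (- 1 / \<alpha>)) *
        (Gamma (real n) / (Gamma (real n - real k * \<alpha>) * Gamma (real k)) *
         x powr (real k - 1 / \<alpha> - 1) * (LINT p|lborel. indicator {0<..<1} p *\<^sub>R
          (p powr (real n - 1 - real k * \<alpha>) * f ((1 - p) * x powr (- 1 / \<alpha>)))))) = u x"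
    proof (cases "0 < x")
      case True
      define t where "t = x powr (- 1 / \<alpha>)"
      have t: "0 < t" using True by (simp add: t_def)
      have "real n - 1 - real k * \<alpha> = b - 1" by (simp add: b_def)
      hence inner: "(LINT p|lborel. indicator {0<..<1} p *\<^sub>R
          (p powr (real n - 1 - real k * \<alpha>) * f ((1 - p) * t))) =
          t powr (- b) * Gamma b * enn2real (A b t)"
        using inner_integral[OF b t] by (simp only: set_lebesgue_integral_def)
      have mix: "enn2real (mix_density n k t) =
          \<alpha> * Gamma (real n) / Gamma (real k) * t powr (- real n) * enn2real (A b t)"
        using k \<alpha>_pos by (simp add: mix_density_def enn2real_mult b_def Gamma_real_nonneg)
      have xt: "x powr (real k - 1 / \<alpha> - 1) * t powr (- b) = x powr (- 1 / \<alpha> - 1) * t powr (- real n)"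
      proof -
        have "b / \<alpha> = real n / \<alpha> - real k" using \<alpha>_pos by (simp add: b_def diff_divide_distrib)
        thus ?thesis by (simp add: t_def powr_powr powr_add[symmetric] algebra_simps)
      qed
      have "h t * (Gamma (real n) / (Gamma b * Gamma (real k)) * x powr (real k - 1 / \<alpha> - 1) *
          (t powr (- b) * Gamma b * enn2real (A b t))) =
        h t * (Gamma (real n) / Gamma (real k)) *
          (x powr (real k - 1 / \<alpha> - 1) * t powr (- b)) * enn2real (A b t)"
        using G by simp
      also have "\<dots> = \<bar>- 1 / \<alpha>\<bar> * x powr (- 1 / \<alpha> - 1) * H t"
        unfolding xt H_def mix using \<alpha>_pos t by (simp add: h0_def mult_ac)
      finally show ?thesis
        using True by (simp only: t_def[symmetric] inner b_def[symmetric] u_def) simp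
    qed (simp add: u_def)
  qed
  also have "\<dots> = enn2real (\<integral>\<^sup>+x. ennreal (u x) \<partial>lborel)"
    by (rule integral_eq_nn_integral) (auto simp: u_def H_def h0_nonneg)
  also have "(\<integral>\<^sup>+x. ennreal (u x) \<partial>lborel) = (\<integral>\<^sup>+x\<in>{0<..}.
      ennreal (\<bar>- 1 / \<alpha>\<bar> * x powr (- 1 / \<alpha> - 1) * H (x powr (- 1 / \<alpha>))) \<partial>lborel)"
    by (intro nn_integral_cong) (auto simp: u_def indicator_def)
  also have "\<dots> = (\<integral>\<^sup>+t\<in>{0<..}. ennreal (H t) \<partial>lborel)"
    using \<alpha>_pos by (intro nn_integral_power_substitution[symmetric]) (auto simp: H_def h0_nonneg)
  also have "\<dots> = mix_mean n k" unfolding mix_mean_eq[OF k] H_def ..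
  finally show ?thesis .
qed

text \<open>Near the limit point \<open>h\<close> is within \<epsilon> of its value \<open>a\<close>
  there and the mixing density has mass 1; elsewhere that density is at most \<epsilon> f, while
  both h f and f have mass 1. The errors are 2 \<epsilon> above and (1 + a) \<epsilon> below, whence
  \<epsilon> = r/(3 + a).\<close>

lemma mix_mean_tendsto:
  fixes N K :: "nat \<Rightarrow> nat"
  assumes N: "filterlim (\<lambda>m. real (N m)) at_top sequentially"
    and K: "(\<lambda>m. real (K m) / real (N m) powr \<alpha>) \<longlonglongrightarrow> s" and s: "0 < s"
    and KN: "\<And>m. 1 \<le> K m" "\<And>m. K m \<le> N m"
    and cont: "isCont h (s powr (- 1 / \<alpha>))"
  shows "(\<lambda>m. enn2real (mix_mean (N m) (K m))) \<longlonglongrightarrow> h (s powr (- 1 / \<alpha>))"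
proof (rule LIMSEQ_I)
  fix r :: real assume r: "0 < r"
  define t0 where "t0 = s powr (- 1 / \<alpha>)"
  define a where "a = h t0"
  have t0: "0 < t0" using s by (simp add: t0_def)
  have a: "0 \<le> a" unfolding a_def using t0 by (rule h_nonneg)
  define \<epsilon> where "\<epsilon> = r / (3 + a)"
  have \<epsilon>: "0 < \<epsilon>" "\<epsilon> * (2 + a) < r" using r a by (auto simp: \<epsilon>_def field_simps)
  have "\<exists>d. 0 < d \<and> d < 1 \<and> (\<forall>t>0. \<bar>t powr (- \<alpha>) / s - 1\<bar> < d \<longrightarrow> \<bar>h t - a\<bar> < \<epsilon>)"
  proof -
    \<comment> \<open>\<open>g\<close> inverts t -> t^(-\<alpha>)/s, so continuity of
      \<open>h\<close> becomes continuity at 1 in the scale of the domination lemma. The cap 1/2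
      below secures d < 1.\<close>
    define g where "g x = (x * s) powr (- 1 / \<alpha>)" for x
    have "isCont (\<lambda>x. h (g x)) 1"
    proof (rule isCont_o2[where f = g and g = h])
      show "isCont g 1" unfolding g_def using s by (intro continuous_intros) auto
      show "isCont h (g 1)" using cont by (simp add: g_def)
    qed
    moreover have "h (g 1) = a" by (simp add: g_def a_def t0_def)
    ultimately have "\<exists>e>0. \<forall>x. \<bar>x - 1\<bar> < e \<longrightarrow> \<bar>h (g x) - a\<bar> < \<epsilon>"
      using \<epsilon>(1) unfolding continuous_at_eps_delta dist_real_def by metis
    then obtain e where e: "0 < e" "\<And>x. \<bar>x - 1\<bar> < e \<Longrightarrow> \<bar>h (g x) - a\<bar> < \<epsilon>" by blast
    have "g (t powr (- \<alpha>) / s) = t" if "0 < t" for t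
      using that s \<alpha>_pos by (simp add: g_def powr_powr)
    hence "\<bar>h t - a\<bar> < \<epsilon>" if "0 < t" "\<bar>t powr (- \<alpha>) / s - 1\<bar> < min e (1 / 2)" for t
      using e(2)[of "t powr (- \<alpha>) / s"] that by simp
    thus ?thesis using e(1) by (intro exI[of _ "min e (1 / 2)"]) auto
  qed
  then obtain d where d: "0 < d" "d < 1"
    and near: "\<And>t. 0 < t \<Longrightarrow> \<bar>t powr (- \<alpha>) / s - 1\<bar> < d \<Longrightarrow> \<bar>h t - a\<bar> < \<epsilon>" by blast
  from mix_density_domination[OF N K s d \<epsilon>(1)] obtain m0 where
    dom: "\<And>m. m0 \<le> m \<Longrightarrow> AE t in lborel. 0 < t \<longrightarrow> d \<le> \<bar>t powr (- \<alpha>) / s - 1\<bar> \<longrightarrow>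
      mix_density (N m) (K m) t \<le> ennreal \<epsilon> * \<phi> t"
    by (auto simp: eventually_sequentially)
  have "\<bar>enn2real (mix_mean (N m) (K m)) - a\<bar> < r" if m: "m0 \<le> m" for m
  proof -
    define M where "M = mix_density (N m) (K m)"
    have [measurable]: "M \<in> borel_measurable borel" unfolding M_def by measurable
    have dm: "AE t in lborel. 0 < t \<longrightarrow> d \<le> \<bar>t powr (- \<alpha>) / s - 1\<bar> \<longrightarrow> M t \<le> ennreal \<epsilon> * \<phi> t"
      using dom[OF m] by (simp add: M_def)
    have M0: "M t = 0" if "t \<le> 0" for t using that by (simp add: M_def mix_density_def A_eq_0)
    have M1: "(\<integral>\<^sup>+t. M t \<partial>lborel) = 1"
    proof -
      have "(\<integral>\<^sup>+t. M t \<partial>lborel) = (\<integral>\<^sup>+t\<in>{0<..}. M t \<partial>lborel)"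
        by (intro nn_integral_cong) (auto simp: indicator_def M0)
      thus ?thesis using integral_mix_density[OF KN(1) KN(2)] by (simp add: M_def)
    qed
    define I where "I = mix_mean (N m) (K m)"
    have It: "I < top" unfolding I_def by (intro mix_mean_less_top KN)
    have ptwise: "AE t in lborel.
       ennreal (h0 t) * M t \<le> ennreal (a + \<epsilon>) * M t + ennreal \<epsilon> * (ennreal (h0 t) * \<phi> t) \<and>
       ennreal (a - \<epsilon>) * M t \<le> ennreal (h0 t) * M t + ennreal (a * \<epsilon>) * \<phi> t"
      using dm
    proof eventually_elim
      fix t assume far: "0 < t \<longrightarrow> d \<le> \<bar>t powr (- \<alpha>) / s - 1\<bar> \<longrightarrow> M t \<le> ennreal \<epsilon> * \<phi> t"
      consider "t \<le> 0" | "0 < t" "\<bar>t powr (- \<alpha>) / s - 1\<bar> < d" | "0 < t" "M t \<le> ennreal \<epsilon> * \<phi> t"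
        using far by linarith
      thus "ennreal (h0 t) * M t \<le> ennreal (a + \<epsilon>) * M t + ennreal \<epsilon> * (ennreal (h0 t) * \<phi> t) \<and>
       ennreal (a - \<epsilon>) * M t \<le> ennreal (h0 t) * M t + ennreal (a * \<epsilon>) * \<phi> t"
      proof cases
        case 1
        thus ?thesis by (simp add: M0)
      next
        case 2
        from near[OF this] have "h0 t \<le> a + \<epsilon>" "a - \<epsilon> \<le> h0 t" using 2 by (auto simp: h0_def)
        hence "ennreal (h0 t) * M t \<le> ennreal (a + \<epsilon>) * M t"
          "ennreal (a - \<epsilon>) * M t \<le> ennreal (h0 t) * M t"
          by (auto intro!: mult_right_mono ennreal_leI)
        thus ?thesis by (auto intro: add_increasing2)
      next
        case 3
        have "ennreal (h0 t) * M t \<le> ennreal (h0 t) * (ennreal \<epsilon> * \<phi> t)"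
          using 3 by (intro mult_left_mono) auto
        moreover have "ennreal (a - \<epsilon>) * M t \<le> ennreal a * (ennreal \<epsilon> * \<phi> t)"
          using 3 \<epsilon> by (intro mult_mono ennreal_leI) auto
        ultimately show ?thesis
          using a \<epsilon> by (auto simp: ennreal_mult mult_ac intro: add_increasing)
      qed
    qed
    have "I \<le> (\<integral>\<^sup>+t. ennreal (a + \<epsilon>) * M t + ennreal \<epsilon> * (ennreal (h0 t) * \<phi> t) \<partial>lborel)"
      unfolding I_def mix_mean_def M_def[symmetric]
      using ptwise by (intro nn_integral_mono_AE) (auto elim: eventually_mono)
    also have "\<dots> = ennreal (a + \<epsilon>) + ennreal \<epsilon>"
      by (simp add: nn_integral_add nn_integral_cmult M1 integral_h\<phi>)
    also have "\<dots> = ennreal (a + \<epsilon> + \<epsilon>)" using a \<epsilon> by (subst ennreal_plus[symmetric]) auto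
    finally have 1: "enn2real I \<le> a + \<epsilon> + \<epsilon>" using a \<epsilon> by (intro enn2real_leI) auto
    have "ennreal (a - \<epsilon>) = (\<integral>\<^sup>+t. ennreal (a - \<epsilon>) * M t \<partial>lborel)"
      by (simp add: nn_integral_cmult M1)
    also have "\<dots> \<le> (\<integral>\<^sup>+t. ennreal (h0 t) * M t + ennreal (a * \<epsilon>) * \<phi> t \<partial>lborel)"
      using ptwise by (intro nn_integral_mono_AE) (auto elim: eventually_mono)
    also have "\<dots> = I + ennreal (a * \<epsilon>)"
      by (simp add: nn_integral_add nn_integral_cmult integral_\<phi> I_def mix_mean_def M_def)
    also have "\<dots> = ennreal (enn2real I + a * \<epsilon>)"
      using It a \<epsilon> by (simp add: ennreal_plus)
    \<comment> \<open>If a < \<epsilon>, then \<open>ennreal (a - \<epsilon>)\<close> is 0, but the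
      real inequality still holds because its left side is negative.\<close>
    finally have "a - \<epsilon> \<le> enn2real I + a * \<epsilon>"
      using a \<epsilon> by (subst (asm) ennreal_le_iff) auto
    moreover have "0 \<le> \<epsilon> * a" using a \<epsilon> by simp
    ultimately show ?thesis using 1 \<epsilon> by (simp add: I_def abs_less_iff algebra_simps)
  qed
  thus "\<exists>m0. \<forall>m\<ge>m0. norm (enn2real (mix_mean (N m) (K m)) - h (s powr (- 1 / \<alpha>))) < r"
    by (auto simp: a_def t0_def)
qed

end

section \<open>Asymptotics of the weight ratio\<close>

text \<open>\<open>h\<close> enters the weights through integrals only; continuity at
  s^(-1/\<alpha>) ties them to its value at that single point, and positivity there gives the ratio
  of the two sides a nonzero denominator.\<close>

theorem proposition4:
  fixes \<alpha> s :: real and f h :: "real \<Rightarrow> real" and n k :: nat and kstar :: "nat \<Rightarrow> nat"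
  assumes "0 < \<alpha>" and "\<alpha> < 1"
    and "stable_density \<alpha> f"
    and "set_borel_measurable lborel {0<..} h"
    and "\<forall>t>0. h t \<ge> 0"
    and "density_on_pos (\<lambda>t. h t * f t)"
    and "1 \<le> k" and "k \<le> n"
    and "0 < s"
    and "isCont h (s powr (- 1 / \<alpha>))" and "h (s powr (- 1 / \<alpha>)) > 0"
    and "\<forall>m\<ge>1. 1 \<le> kstar m \<and> kstar m \<le> m"
    and "(\<lambda>m. real (kstar m) / real m powr \<alpha>) \<longlonglongrightarrow> s"
  shows "((\<lambda>m. (gibbs_V \<alpha> f h (n + m) (k + kstar m) / gibbs_V \<alpha> f h n k) /
               (h (s powr (- 1 / \<alpha>)) * s ^ k * \<alpha> ^ kstar m * Gamma (real (kstar m)) *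
                  Gamma (real n) * real m powr (- (real n - real k * \<alpha>)) /
                (S_expectation \<alpha> f n k (\<lambda>x. h (x powr (- 1 / \<alpha>))) *
                  Gamma (real m) * Gamma (real k)))) \<longlonglongrightarrow> 1) \<and>
         (\<forall>m\<ge>1.
            h (s powr (- 1 / \<alpha>)) * s ^ k * \<alpha> ^ kstar m * Gamma (real (kstar m)) *
              Gamma (real n) * real m powr (- (real n - real k * \<alpha>)) /
              (S_expectation \<alpha> f n k (\<lambda>x. h (x powr (- 1 / \<alpha>))) *
                Gamma (real m) * Gamma (real k)) =
            \<alpha> ^ (k + kstar m - 1) * h (s powr (- 1 / \<alpha>)) * s ^ k * Gamma (real (kstar m)) *
              real m powr (- (real n - real k * \<alpha>)) /
              (gibbs_V \<alpha> f h n k * Gamma (real m)))"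
proof -
  interpret stable_mixture \<alpha> f h
    using assms by unfold_locales auto
  define t0 where "t0 = s powr (- 1 / \<alpha>)"
  have t0: "0 < t0" using assms(9) by (simp add: t0_def)
  have k: "1 \<le> k" "k \<le> n" and s: "0 < s" and \<alpha>: "0 < \<alpha>" "\<alpha> < 1" by fact+
  have ht0: "isCont h t0" "0 < h t0" using assms(10,11) by (simp_all add: t0_def)
  define E where "E = S_expectation \<alpha> f n k (\<lambda>x. h (x powr (- 1 / \<alpha>)))"
  have E: "E = enn2real (mix_mean n k)" unfolding E_def by (rule S_expectation_eq[OF k])
  have E0: "0 < E"
    unfolding E using mix_mean_pos[OF k t0 ht0] mix_mean_less_top[OF k]
    by (simp add: enn2real_positive_iff)
  have G: "Gamma (real n) \<noteq> 0" "Gamma (real k) \<noteq> 0"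
    using k by (intro Gamma_real_neq_0; simp)+
  have V: "gibbs_V \<alpha> f h n k = \<alpha> ^ (k - 1) * Gamma (real k) / Gamma (real n) * E"
    using gibbs_V_eq[OF k] by (simp add: E)

  define N where "N m = n + m" for m
  define K where "K m = k + kstar m" for m
  have ks: "1 \<le> kstar m" "kstar m \<le> m" if "1 \<le> m" for m using assms(12) that by auto
  have lim: "(\<lambda>m. real (kstar m) / real m powr \<alpha>) \<longlonglongrightarrow> s" by fact
  have ma: "filterlim (\<lambda>m. real m powr \<alpha>) at_top sequentially"
    using \<alpha> by real_asymp
  have mi: "filterlim (\<lambda>m. real m) at_top sequentially" by real_asymp
  have kinf: "filterlim (\<lambda>m. real (kstar m)) at_top sequentially"
  proof -
    have "filterlim (\<lambda>m. real (kstar m) / real m powr \<alpha> * real m powr \<alpha>) at_top sequentially"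
      by (rule filterlim_tendsto_pos_mult_at_top[OF lim s ma])
    moreover have "\<forall>\<^sub>F m in sequentially.
        real (kstar m) / real m powr \<alpha> * real m powr \<alpha> = real (kstar m)"
      using eventually_gt_at_top[of 0] by eventually_elim simp
    ultimately show ?thesis by (rule filterlim_cong[THEN iffD1, OF refl refl, rotated])
  qed
  have Ninf: "filterlim (\<lambda>m. real (N m)) at_top sequentially" unfolding N_def by real_asymp
  have Klim: "(\<lambda>m. real (K m) / real (N m) powr \<alpha>) \<longlonglongrightarrow> s"
  proof -
    have "(\<lambda>m. (real k / real m powr \<alpha> + real (kstar m) / real m powr \<alpha>) *
        (real m / real (N m)) powr \<alpha>) \<longlonglongrightarrow> (0 + s) * 1 powr \<alpha>"
    proof (intro tendsto_mult tendsto_add tendsto_powr tendsto_const lim)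
      show "(\<lambda>m. real k / real m powr \<alpha>) \<longlonglongrightarrow> 0" using \<alpha> by real_asymp
      show "(\<lambda>m. real m / real (N m)) \<longlonglongrightarrow> 1" unfolding N_def by real_asymp
    qed simp
    moreover have "\<forall>\<^sub>F m in sequentially. (real k / real m powr \<alpha> + real (kstar m) / real m powr \<alpha>) *
        (real m / real (N m)) powr \<alpha> = real (K m) / real (N m) powr \<alpha>"
      using eventually_gt_at_top[of 0]
      by eventually_elim (simp add: K_def powr_divide add_divide_distrib[symmetric])
    ultimately show ?thesis by (simp add: Lim_transform_eventually)
  qed

  define I where "I m = enn2real (mix_mean (N m) (K m))" for m
  have Ilim: "I \<longlonglongrightarrow> h t0"
  proof -
    \<comment> \<open>\<open>kstar 0\<close> is unconstrained, whereas the convergence lemma asks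
      for 1 <= K <= N at every index; at 0 the value k is substituted.\<close>
    define K' where "K' m = (if m = 0 then k else K m)" for m
    have ev: "\<forall>\<^sub>F m in sequentially. K m = K' m"
      by (rule eventually_mono[OF eventually_gt_at_top[of 0]]) (simp add: K'_def)
    have K'lim: "(\<lambda>m. real (K' m) / real (N m) powr \<alpha>) \<longlonglongrightarrow> s"
      by (rule Lim_transform_eventually[OF Klim]) (use ev in eventually_elim, simp)
    have bd: "1 \<le> K' m" "K' m \<le> N m" for m
      using ks[of m] k by (auto simp: K'_def K_def N_def)
    have "(\<lambda>m. enn2real (mix_mean (N m) (K' m))) \<longlonglongrightarrow> h t0"
      unfolding t0_def using ht0(1) by (intro mix_mean_tendsto[OF Ninf K'lim s bd]) (simp add: t0_def)
    thus ?thesis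
      by (rule Lim_transform_eventually) (use ev in eventually_elim, simp add: I_def)
  qed

  \<comment> \<open>\<open>P\<close> and \<open>Q\<close> are the relative errors in Gamma(kstar m +
    k) ~ Gamma(kstar m) (kstar m)^k and Gamma(m + n) ~ Gamma(m) m^n.\<close>
  define P where "P m = Gamma (real (kstar m) + real k) / (Gamma (real (kstar m)) * real (kstar m) ^ k)" for m
  define Q where "Q m = Gamma (real m + real n) / (Gamma (real m) * real m ^ n)" for m
  have Plim: "P \<longlonglongrightarrow> 1" unfolding P_def by (rule Gamma_add_asymptotic[OF kinf])
  have Qlim: "Q \<longlonglongrightarrow> 1" unfolding Q_def by (rule Gamma_add_asymptotic[OF mi])
  have "(\<lambda>m. I m / h t0 * (P m / Q m) * ((real (kstar m) / real m powr \<alpha>) ^ k / s ^ k)) \<longlonglongrightarrow>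
      h t0 / h t0 * (1 / 1) * (s ^ k / s ^ k)"
    using ht0 s by (intro tendsto_mult tendsto_divide tendsto_power tendsto_const Ilim Plim Qlim lim) auto
  hence main: "(\<lambda>m. I m / h t0 * (P m / Q m) * ((real (kstar m) / real m powr \<alpha>) ^ k / s ^ k)) \<longlonglongrightarrow> 1"
    using ht0 s by simp

  define W where "W m = (gibbs_V \<alpha> f h (n + m) (k + kstar m) / gibbs_V \<alpha> f h n k) /
               (h t0 * s ^ k * \<alpha> ^ kstar m * Gamma (real (kstar m)) *
                  Gamma (real n) * real m powr (- (real n - real k * \<alpha>)) /
                (E * Gamma (real m) * Gamma (real k)))" for m
  \<comment> \<open>An exact identity: the ratio factors into the mean over its limit, the two Gamma
    errors, and the deviation of kstar m / m^\<alpha> from s. The powers m^(k \<alpha>) and m^n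
    combine to the stated power of m.\<close>
  have Weq: "I m / h t0 * (P m / Q m) * ((real (kstar m) / real m powr \<alpha>) ^ k / s ^ k) = W m"
    if m: "1 \<le> m" for m
  proof -
    have Gm: "Gamma (real m) \<noteq> 0" "Gamma (real m + real n) \<noteq> 0" "Gamma (real (kstar m)) \<noteq> 0"
      using m ks[OF m] by (intro Gamma_real_neq_0; simp)+
    have V': "gibbs_V \<alpha> f h (n + m) (k + kstar m) = \<alpha> ^ (k - 1) * \<alpha> ^ kstar m *
        Gamma (real (kstar m) + real k) / Gamma (real m + real n) * I m"
    proof -
      have "k + kstar m - 1 = (k - 1) + kstar m" using k by simp
      hence p: "\<alpha> ^ (k + kstar m - 1) = \<alpha> ^ (k - 1) * \<alpha> ^ kstar m" by (simp add: power_add)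
      have "gibbs_V \<alpha> f h (n + m) (k + kstar m) = \<alpha> ^ (k + kstar m - 1) *
          Gamma (real (k + kstar m)) / Gamma (real (n + m)) * I m"
        unfolding I_def N_def K_def using k ks[OF m] by (intro gibbs_V_eq) auto
      thus ?thesis unfolding p by (simp add: add.commute)
    qed
    have pw: "real m powr (- (real n - real k * \<alpha>)) = (real m powr \<alpha>) ^ k / real m ^ n"
    proof -
      have "real m powr (- (real n - real k * \<alpha>)) = real m powr (\<alpha> * real k) / real m powr real n"
        using m by (simp add: powr_diff[symmetric] mult.commute)
      thus ?thesis using m by (simp add: powr_powr[symmetric] powr_realpow)
    qed
    show ?thesis
      unfolding W_def V V' pw P_def Q_def
      using G Gm E0 \<alpha> s ht0(2) m ks[OF m]
      by (simp add: power_divide field_simps)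
  qed
  have "W \<longlonglongrightarrow> 1"
  proof (rule Lim_transform_eventually[OF main])
    show "\<forall>\<^sub>F m in sequentially.
      I m / h t0 * (P m / Q m) * ((real (kstar m) / real m powr \<alpha>) ^ k / s ^ k) = W m"
      using eventually_ge_at_top[of 1] by eventually_elim (rule Weq)
  qed
  \<comment> \<open>Exact as well: inserting \<open>V\<close> cancels the expectation and
    Gamma(n)/Gamma(k), and \<alpha>^(k-1) joins \<alpha>^(kstar m).\<close>
  moreover have "h t0 * s ^ k * \<alpha> ^ kstar m * Gamma (real (kstar m)) *
              Gamma (real n) * real m powr (- (real n - real k * \<alpha>)) /
              (E * Gamma (real m) * Gamma (real k)) =
            \<alpha> ^ (k + kstar m - 1) * h t0 * s ^ k * Gamma (real (kstar m)) *
              real m powr (- (real n - real k * \<alpha>)) /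
              (gibbs_V \<alpha> f h n k * Gamma (real m))" if m: "1 \<le> m" for m
  proof -
    have "k + kstar m - 1 = (k - 1) + kstar m" using k by simp
    hence p: "\<alpha> ^ (k + kstar m - 1) = \<alpha> ^ (k - 1) * \<alpha> ^ kstar m" by (simp add: power_add)
    have "Gamma (real m) \<noteq> 0" using m by (intro Gamma_real_neq_0) simp
    thus ?thesis unfolding V p using G E0 \<alpha> by (simp add: divide_simps)
  qed
  ultimately show ?thesis
    unfolding E_def[symmetric] t0_def[symmetric] W_def by blast
qed

end
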